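(* Let $\mathcal{A}=\{H_1,\ldots,H_l\}$ be a hyperplane arrangement in $\mathbb{C}\mathbb{P}^n$ with Orlik-Solomon algebra $A$. Let $w_i=a_1^i x_1+\cdots+a_l^i x_l$, $i=1,\ldots,n$, be an $n$-tuple of vectors in $A^1$, and let $v_1,\ldots,v_l\in\mathbb{C}^n$ be the columns of the $n\times l$ matrix whose rows are the coefficients of $w_1,\ldots,w_n$ in the canonical basis, i.e. $v_j=(a_j^1,\ldots,a_j^n)^T$. For each flat $S$ of the intersection lattice let $v_S:=\sum_{H_i\supseteq S}v_i$. Then the wedge product $w_1\wedge\cdots\wedge w_n$ is zero in $A$ if and only if, for every flag $S_1\supseteq\cdots\supseteq S_n$, the vectors $v_{S_1},\ldots,v_{S_n}$ span a subspace of dimension lower than $n$.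
   Context: Let $\mathcal{A}=\{H_1,\ldots,H_l\}$ be an arrangement of distinct hyperplanes in $\mathbb{C}\mathbb{P}^n$. Orlik-Solomon algebra: let $E$ be the exterior algebra of $A^1:=\mathbb{C}^l$ with canonical generators $x_1,\ldots,x_l$ (one for each hyperplane), and let $K$ be the ideal of $E$ generated by (i) the elements $\partial(x_{i_1}\wedge\cdots\wedge x_{i_m}):=\sum_{j=1}^m(-1)^j x_{i_1}\wedge\cdots\wedge x_{i_{j-1}}\wedge x_{i_{j+1}}\wedge\cdots\wedge x_{i_m}$ for all $H_{i_1},\ldots,H_{i_m}$ that intersect non-generically (i.e. with nonempty intersection of codimension less than $m$), and (ii) the monomials $x_{i_1}\wedge\cdots\wedge x_{i_m}$ with $H_{i_1}\cap\cdots\cap H_{i_m}=\emptyset$. The Orlik-Solomon algebra is $A=E/K$; it is graded, with homogeneous part of degree $i$ denoted $A^i$. A flat is a nonempty intersection of some hyperplanes of the arrangement. A flag is a sequence of flats $S_1\supseteq\cdots\supseteq S_n$ that starts at a hyperplane and ends at a point, $S_i$ having codimension $i$ in $\mathbb{C}\mathbb{P}^n$. *)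

theory Defs
  imports Complex_Main "HOL-Algebra.QuotRing" "HOL-Library.Function_Algebras"
begin

section \<open>Complex vectors with an explicit index set\<close>

text \<open>
  The dimensions \<open>n\<close>, \<open>n + 1\<close> and \<open>l\<close> all occur together, so vectors are functions
  \<open>'i \<Rightarrow> complex\<close>, and \<open>coord_space I\<close> is the coordinate space of those supported on \<open>I\<close>.
\<close>

definition fscale :: "complex \<Rightarrow> ('i \<Rightarrow> complex) \<Rightarrow> 'i \<Rightarrow> complex"
  where "fscale c f = (\<lambda>i. c * f i)"

global_interpretation cvec: vector_space fscale
  defines cvec_span = cvec.span and cvec_dim = cvec.dim
  by unfold_locales (auto simp: fscale_def fun_eq_iff algebra_simps)

definition coord_space :: "'i set \<Rightarrow> ('i \<Rightarrow> complex) set"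
  where "coord_space I = {x. \<forall>i. i \<notin> I \<longrightarrow> x i = 0}"


section \<open>Hyperplane arrangements in complex projective space\<close>

text \<open>
  Points of the projective \<open>n\<close>-space are the one-dimensional subspaces of the space with
  (homogeneous) coordinates \<open>0, \<dots>, n\<close>.
\<close>

type_synonym point = "(nat \<Rightarrow> complex) set"

definition proj_space :: "nat \<Rightarrow> point set"
  where "proj_space n = {cvec_span {x} | x. x \<in> coord_space {0..n} \<and> x \<noteq> 0}"

definition hyperplane :: "nat \<Rightarrow> point set \<Rightarrow> bool"
  where "hyperplane n X \<longleftrightarrow>
    (\<exists>c \<in> coord_space {0..n}. c \<noteq> 0 \<and>
      X = {p \<in> proj_space n. \<forall>x\<in>p. (\<Sum>i=0..n. c i * x i) = 0})"

text \<open>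
  For a projective subspace \<open>X\<close>, the union \<open>\<Union>X\<close> of its points (which are lines) is the linear
  subspace whose projectivization is \<open>X\<close>, unless \<open>X\<close> is empty.  In both cases
  the projective dimension of \<open>X\<close> is \<open>cvec_dim (\<Union>X) - 1\<close>, and the empty set has
  codimension \<open>n + 1\<close>.
\<close>

definition codim :: "nat \<Rightarrow> point set \<Rightarrow> nat"
  where "codim n X = n + 1 - cvec_dim (\<Union>X)"

definition arrangement :: "nat \<Rightarrow> nat \<Rightarrow> (nat \<Rightarrow> point set) \<Rightarrow> bool"
  where "arrangement n l H \<longleftrightarrow> (\<forall>i\<in>{1..l}. hyperplane n (H i)) \<and> inj_on H {1..l}"

definition intersection :: "nat \<Rightarrow> (nat \<Rightarrow> point set) \<Rightarrow> nat set \<Rightarrow> point set"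
  where "intersection n H I = proj_space n \<inter> (\<Inter>i\<in>I. H i)"

definition flat :: "nat \<Rightarrow> nat \<Rightarrow> (nat \<Rightarrow> point set) \<Rightarrow> point set \<Rightarrow> bool"
  where "flat n l H X \<longleftrightarrow>
    X \<noteq> {} \<and> (\<exists>I. I \<noteq> {} \<and> I \<subseteq> {1..l} \<and> X = intersection n H I)"

text \<open>
  Only the values \<open>S 1, \<dots>, S n\<close> matter.  The first one, a flat of codimension 1, is one of the
  hyperplanes; the last one, a flat of codimension \<open>n\<close>, is a point.
\<close>

definition flag :: "nat \<Rightarrow> nat \<Rightarrow> (nat \<Rightarrow> point set) \<Rightarrow> (nat \<Rightarrow> point set) \<Rightarrow> bool"
  where "flag n l H S \<longleftrightarrow>
    (\<forall>i\<in>{1..n}. flat n l H (S i) \<and> codim n (S i) = i) \<and>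
    (\<forall>i\<in>{1..<n}. S (Suc i) \<subseteq> S i)"


section \<open>The exterior algebra\<close>

text \<open>
  An element of the exterior algebra on generators \<open>x\<^sub>1, \<dots>, x\<^sub>l\<close> is given by its coefficients
  with respect to the basis of the monomials \<open>x\<^sub>S = x\<^bsub>s\<^sub>1\<^esub> \<and> \<dots> \<and> x\<^bsub>s\<^sub>k\<^esub>\<close>, where
  \<open>S = {s\<^sub>1 < \<dots> < s\<^sub>k} \<subseteq> {1..l}\<close>.  For disjoint \<open>T\<close> and \<open>U\<close> one has
  \<open>x\<^sub>T \<and> x\<^sub>U = \<plusminus> x\<^bsub>T \<union> U\<^esub>\<close>, the sign being that of the permutation which sorts
  \<open>T\<close> followed by \<open>U\<close>.
\<close>

type_synonym ext = "nat set \<Rightarrow> complex"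

definition inversions :: "nat set \<Rightarrow> nat set \<Rightarrow> nat"
  where "inversions T U = card {(i, j). i \<in> T \<and> j \<in> U \<and> j < i}"

definition wedge :: "ext \<Rightarrow> ext \<Rightarrow> ext"
  where "wedge f g = (\<lambda>S. \<Sum>T\<in>Pow S. (-1) ^ inversions T (S - T) * f T * g (S - T))"

definition ext_monom :: "nat set \<Rightarrow> ext"
  where "ext_monom S = (\<lambda>T. if T = S then 1 else 0)"

definition gen :: "nat \<Rightarrow> ext"
  where "gen i = ext_monom {i}"

definition ext_alg :: "nat \<Rightarrow> ext ring"
  where "ext_alg l =
    \<lparr>carrier = coord_space (Pow {1..l}), mult = wedge, one = ext_monom {}, zero = 0, add = (+)\<rparr>"

definition wedge_list :: "ext list \<Rightarrow> ext"
  where "wedge_list ws = foldr wedge ws (ext_monom {})"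

definition gens :: "nat list \<Rightarrow> ext"
  where "gens is = wedge_list (map gen is)"

definition boundary :: "nat list \<Rightarrow> ext"
  where "boundary is =
    (\<Sum>j=1..length is. fscale ((-1) ^ j) (gens (take (j - 1) is @ drop j is)))"

definition linear_elem :: "nat \<Rightarrow> (nat \<Rightarrow> complex) \<Rightarrow> ext"
  where "linear_elem l c = (\<Sum>j=1..l. fscale (c j) (gen j))"

text \<open>
  The following facts show that these definitions do give the exterior algebra.  In particular,
  \<open>ext_alg l\<close> is a ring, so that ideals and quotients have their usual meaning.
\<close>

lemma inversions_Un_left:
  assumes "finite A" "finite B" "finite C" "A \<inter> B = {}"
  shows "inversions (A \<union> B) C = inversions A C + inversions B C"
proof -
  have "{(i, j). i \<in> A \<union> B \<and> j \<in> C \<and> j < i} =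
      {(i, j). i \<in> A \<and> j \<in> C \<and> j < i} \<union> {(i, j). i \<in> B \<and> j \<in> C \<and> j < i}" by auto
  moreover have "finite {(i, j). i \<in> A \<and> j \<in> C \<and> j < i}"
    by (rule finite_subset[of _ "A \<times> C"]) (use assms in auto)
  moreover have "finite {(i, j). i \<in> B \<and> j \<in> C \<and> j < i}"
    by (rule finite_subset[of _ "B \<times> C"]) (use assms in auto)
  ultimately show ?thesis
    unfolding inversions_def using assms(4) by (subst card_Un_disjoint[symmetric]) auto
qed

lemma inversions_Un_right:
  assumes "finite A" "finite B" "finite C" "B \<inter> C = {}"
  shows "inversions A (B \<union> C) = inversions A B + inversions A C"
proof -
  have "{(i, j). i \<in> A \<and> j \<in> B \<union> C \<and> j < i} =
      {(i, j). i \<in> A \<and> j \<in> B \<and> j < i} \<union> {(i, j). i \<in> A \<and> j \<in> C \<and> j < i}" by auto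
  moreover have "finite {(i, j). i \<in> A \<and> j \<in> B \<and> j < i}"
    by (rule finite_subset[of _ "A \<times> B"]) (use assms in auto)
  moreover have "finite {(i, j). i \<in> A \<and> j \<in> C \<and> j < i}"
    by (rule finite_subset[of _ "A \<times> C"]) (use assms in auto)
  ultimately show ?thesis
    unfolding inversions_def using assms(4) by (subst card_Un_disjoint[symmetric]) auto
qed

lemma inversions_empty [simp]: "inversions {} U = 0" "inversions T {} = 0"
  by (simp_all add: inversions_def)

lemma wedge_infinite: "infinite S \<Longrightarrow> wedge f g S = 0"
  by (simp add: wedge_def)

lemma wedge_assoc: "wedge (wedge f g) h = wedge f (wedge g h)"
proof
  fix S
  show "wedge (wedge f g) h S = wedge f (wedge g h) S"
  proof (cases "finite S")
    case True
    note fin = finite_subset[OF _ True]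
    define F where "F = (\<lambda>U V. (-1) ^ (inversions U V + inversions U (S - (U \<union> V))
      + inversions V (S - (U \<union> V))) * f U * g V * h (S - (U \<union> V)))"
    have "wedge (wedge f g) h S = (\<Sum>T\<in>Pow S. \<Sum>U\<in>Pow T. F U (T - U))"
      unfolding wedge_def sum_distrib_left sum_distrib_right
    proof (intro sum.cong refl)
      fix T U assume TU: "T \<in> Pow S" "U \<in> Pow T"
      then have T: "T = U \<union> (T - U)" by auto
      have "inversions T (S - T) = inversions U (S - T) + inversions (T - U) (S - T)"
        by (subst T, subst inversions_Un_left) (use TU in \<open>auto intro: fin\<close>)
      moreover have "S - (U \<union> (T - U)) = S - T" using T by simp
      ultimately show "(- 1) ^ inversions T (S - T) *
          ((- 1) ^ inversions U (T - U) * f U * g (T - U)) * h (S - T) = F U (T - U)"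
        unfolding F_def by (simp add: power_add ac_simps)
    qed
    also have "\<dots> = (\<Sum>(T, U)\<in>Sigma (Pow S) Pow. F U (T - U))"
      by (rule sum.Sigma) (use True in \<open>auto intro: fin\<close>)
    also have "\<dots> = (\<Sum>(U, V)\<in>Sigma (Pow S) (\<lambda>U. Pow (S - U)). F U V)"
      by (rule sum.reindex_bij_witness[where i = "\<lambda>(U, V). (U \<union> V, U)"
            and j = "\<lambda>(T, U). (U, T - U)"]) auto
    also have "\<dots> = (\<Sum>U\<in>Pow S. \<Sum>V\<in>Pow (S - U). F U V)"
      by (rule sum.Sigma[symmetric]) (use True in \<open>auto intro: fin\<close>)
    also have "\<dots> = wedge f (wedge g h) S"
      unfolding wedge_def sum_distrib_left sum_distrib_right
    proof (intro sum.cong refl)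
      fix U V assume UV: "U \<in> Pow S" "V \<in> Pow (S - U)"
      then have W: "S - U = V \<union> (S - (U \<union> V))" by auto
      have "inversions U (S - U) = inversions U V + inversions U (S - (U \<union> V))"
        by (subst W, subst inversions_Un_right) (use UV in \<open>auto intro: fin\<close>)
      moreover have "S - U - V = S - (U \<union> V)" by auto
      ultimately show "F U V = (- 1) ^ inversions U (S - U) * f U *
          ((- 1) ^ inversions V (S - U - V) * g V * h (S - U - V))"
        unfolding F_def by (simp add: power_add ac_simps)
    qed
    finally show ?thesis .
  qed (simp add: wedge_infinite)
qed

lemma wedge_closed:
  assumes "f \<in> coord_space (Pow {1..l})" "g \<in> coord_space (Pow {1..l})"
  shows "wedge f g \<in> coord_space (Pow {1..l})"
proof -
  have "wedge f g S = 0" if "\<not> S \<subseteq> {1..l}" for S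
    unfolding wedge_def
  proof (intro sum.neutral ballI)
    fix T assume "T \<in> Pow S"
    then have "T \<notin> Pow {1..l} \<or> S - T \<notin> Pow {1..l}" using that by auto
    then have "f T = 0 \<or> g (S - T) = 0"
      using assms unfolding coord_space_def by blast
    then show "(- 1) ^ inversions T (S - T) * f T * g (S - T) = 0" by auto
  qed
  then show ?thesis by (auto simp: coord_space_def)
qed

lemma wedge_monom:
  assumes "finite T" "finite U"
  shows "wedge (ext_monom T) (ext_monom U) =
    (if T \<inter> U = {} then fscale ((-1) ^ inversions T U) (ext_monom (T \<union> U)) else 0)"
proof
  fix S
  show "wedge (ext_monom T) (ext_monom U) S =
    (if T \<inter> U = {} then fscale ((-1) ^ inversions T U) (ext_monom (T \<union> U)) else 0) S"
  proof (cases "finite S")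
    case True
    have "wedge (ext_monom T) (ext_monom U) S =
      (\<Sum>T'\<in>Pow S. if T' = T then (if S - T = U then (-1) ^ inversions T U else 0) else 0)"
      unfolding wedge_def by (intro sum.cong refl) (auto simp: ext_monom_def)
    also have "\<dots> = (if T \<subseteq> S \<and> S - T = U then (-1) ^ inversions T U else 0)"
      using True by (simp add: sum.delta)
    also have "T \<subseteq> S \<and> S - T = U \<longleftrightarrow> T \<inter> U = {} \<and> S = T \<union> U" by auto
    finally show ?thesis by (auto simp: fscale_def ext_monom_def)
  next
    case False
    then show ?thesis using assms
      by (auto simp: wedge_infinite fscale_def ext_monom_def)
  qed
qed

lemma wedge_one_left:
  assumes "f \<in> coord_space (Pow {1..l})"
  shows "wedge (ext_monom {}) f = f"
proof
  fix S
  show "wedge (ext_monom {}) f S = f S"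
  proof (cases "finite S")
    case True
    have "wedge (ext_monom {}) f S = (\<Sum>T\<in>Pow S. if T = {} then f S else 0)"
      unfolding wedge_def by (intro sum.cong refl) (auto simp: ext_monom_def)
    then show ?thesis using True by (simp add: sum.delta)
  next
    case False
    then have "\<not> S \<subseteq> {1..l}" using finite_subset by blast
    with assms False show ?thesis by (auto simp: wedge_infinite coord_space_def)
  qed
qed

lemma wedge_one_right:
  assumes "f \<in> coord_space (Pow {1..l})"
  shows "wedge f (ext_monom {}) = f"
proof
  fix S
  show "wedge f (ext_monom {}) S = f S"
  proof (cases "finite S")
    case True
    have "wedge f (ext_monom {}) S = (\<Sum>T\<in>Pow S. if T = S then f S else 0)"
      unfolding wedge_def by (intro sum.cong refl) (auto simp: ext_monom_def)
    then show ?thesis using True by (simp add: sum.delta)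
  next
    case False
    then have "\<not> S \<subseteq> {1..l}" using finite_subset by blast
    with assms False show ?thesis by (auto simp: wedge_infinite coord_space_def)
  qed
qed

lemma wedge_add_left: "wedge (f + g) h = wedge f h + wedge g h"
  by (auto simp: wedge_def fun_eq_iff algebra_simps sum.distrib)

lemma wedge_add_right: "wedge f (g + h) = wedge f g + wedge f h"
  by (auto simp: wedge_def fun_eq_iff algebra_simps sum.distrib)

lemma ring_ext_alg: "ring (ext_alg l)"
proof (rule ringI)
  show "abelian_group (ext_alg l)"
  proof (rule abelian_groupI)
    fix x assume "x \<in> carrier (ext_alg l)"
    then show "\<exists>y\<in>carrier (ext_alg l). y \<oplus>\<^bsub>ext_alg l\<^esub> x = \<zero>\<^bsub>ext_alg l\<^esub>"
      by (intro bexI[of _ "- x"]) (auto simp: ext_alg_def coord_space_def)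
  qed (auto simp: ext_alg_def coord_space_def add.assoc add.commute)
  show "monoid (ext_alg l)"
  proof (rule monoidI)
    show "\<one>\<^bsub>ext_alg l\<^esub> \<in> carrier (ext_alg l)"
      by (simp add: ext_alg_def coord_space_def ext_monom_def)
  qed (simp_all only: ext_alg_def monoid.simps partial_object.simps
      wedge_closed wedge_assoc wedge_one_left wedge_one_right)
qed (auto simp: ext_alg_def wedge_add_left wedge_add_right)

lemma gen_sq: "wedge (gen i) (gen i) = 0"
  by (simp add: gen_def wedge_monom)

lemma inversions_less:
  assumes "i < j"
  shows "inversions {i} {j} = 0" "inversions {j} {i} = 1"
proof -
  have "{(a, b). a \<in> {i} \<and> b \<in> {j} \<and> b < a} = {}"
    "{(a, b). a \<in> {j} \<and> b \<in> {i} \<and> b < a} = {(j, i)}" using assms by auto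
  then show "inversions {i} {j} = 0" "inversions {j} {i} = 1"
    unfolding inversions_def by (metis card.empty, simp)
qed

lemma gen_anticomm: "wedge (gen i) (gen j) = - wedge (gen j) (gen i)"
  by (cases i j rule: linorder_cases)
    (simp_all add: gen_def wedge_monom inversions_less insert_commute fscale_def fun_eq_iff)

lemma gens_sorted: "sorted_wrt (<) is \<Longrightarrow> gens is = ext_monom (set is)"
proof (induction "is")
  case Nil
  show ?case by (simp add: gens_def wedge_list_def)
next
  case (Cons i "is")
  then have "{(a, b). a \<in> {i} \<and> b \<in> set is \<and> b < a} = {}" by auto
  then have "inversions {i} (set is) = 0" unfolding inversions_def by (metis card.empty)
  moreover have "i \<notin> set is" "gens is = ext_monom (set is)" using Cons by auto
  moreover have "gens (i # is) = wedge (gen i) (gens is)" by (simp add: gens_def wedge_list_def)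
  ultimately show ?case
    by (simp add: gen_def wedge_monom fscale_def)
qed


section \<open>The Orlik-Solomon algebra\<close>

definition os_relations :: "nat \<Rightarrow> nat \<Rightarrow> (nat \<Rightarrow> point set) \<Rightarrow> ext set"
  where "os_relations n l H =
    {boundary is | is. set is \<subseteq> {1..l} \<and> distinct is \<and>
       intersection n H (set is) \<noteq> {} \<and> codim n (intersection n H (set is)) < length is} \<union>
    {gens is | is. set is \<subseteq> {1..l} \<and> distinct is \<and> intersection n H (set is) = {}}"

definition os_ideal :: "nat \<Rightarrow> nat \<Rightarrow> (nat \<Rightarrow> point set) \<Rightarrow> ext set"
  where "os_ideal n l H = genideal (ext_alg l) (os_relations n l H)"

definition os_alg :: "nat \<Rightarrow> nat \<Rightarrow> (nat \<Rightarrow> point set) \<Rightarrow> ext set ring"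
  where "os_alg n l H = ext_alg l Quot os_ideal n l H"

definition os_class :: "nat \<Rightarrow> nat \<Rightarrow> (nat \<Rightarrow> point set) \<Rightarrow> ext \<Rightarrow> ext set"
  where "os_class n l H f = os_ideal n l H +>\<^bsub>ext_alg l\<^esub> f"


section \<open>The vectors attached to flats\<close>

text \<open>Here \<open>a i j\<close> is the coefficient of \<open>x\<^sub>j\<close> in \<open>w\<^sub>i\<close>.\<close>

definition column :: "nat \<Rightarrow> (nat \<Rightarrow> nat \<Rightarrow> complex) \<Rightarrow> nat \<Rightarrow> nat \<Rightarrow> complex"
  where "column n a j = (\<lambda>i. if i \<in> {1..n} then a i j else 0)"

definition flat_vec ::
    "nat \<Rightarrow> nat \<Rightarrow> (nat \<Rightarrow> point set) \<Rightarrow> (nat \<Rightarrow> nat \<Rightarrow> complex) \<Rightarrow> point set \<Rightarrow> nat \<Rightarrow> complex"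
  where "flat_vec n l H a X = (\<Sum>j | j \<in> {1..l} \<and> X \<subseteq> H j. column n a j)"

end

theory Submission
  imports Defs "Jordan_Normal_Form.Determinant"
begin

text \<open>
  Write \<open>c\<^sub>j\<close> for a linear form that defines \<open>H j\<close>.  The codimension of an intersection of hyperplanes
  is the rank of the corresponding forms, and the intersection is empty if and only if this rank
  is \<open>n + 1\<close>.  So the relations of the Orlik-Solomon algebra and the flags only depend on linear
  dependence among the \<open>c\<^sub>j\<close>.

  A flag \<open>S\<close> defines an algebra homomorphism \<open>h\<^sub>S\<close> from the exterior algebra on the hyperplanes to
  the exterior algebra on \<open>e\<^sub>1, \<dots>, e\<^sub>n\<close>, which sends \<open>x\<^sub>j\<close> to the sum of the \<open>e\<^sub>k\<close> with
  \<open>S\<^sub>k \<subseteq> H\<^sub>j\<close>.  The image of \<open>w\<^sub>i\<close> has the coordinates \<open>(v\<^bsub>S\<^sub>1\<^esub>)\<^sub>i, \<dots>, (v\<^bsub>S\<^sub>n\<^esub>)\<^sub>i\<close>,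
  hence \<open>h\<^sub>S (w\<^sub>1 \<and> \<dots> \<and> w\<^sub>n)\<close> is the determinant of \<open>v\<^bsub>S\<^sub>1\<^esub>, \<dots>, v\<^bsub>S\<^sub>n\<^esub>\<close> times
  \<open>e\<^sub>1 \<and> \<dots> \<and> e\<^sub>n\<close>, and it vanishes if and only if these vectors span less than \<open>n\<close> dimensions
  (\<open>flag_hom_product_zero_iff\<close>).  The theorem thus says that an element of degree \<open>n\<close> lies in the
  Orlik-Solomon ideal if and only if every \<open>h\<^sub>S\<close> kills it.

  Each \<open>h\<^sub>S\<close> kills the ideal (\<open>flag_hom_kills_os_ideal\<close>).  The image of \<open>x\<^sub>j\<close> is determined by the
  first \<open>S\<^sub>k\<close> that is contained in \<open>H\<^sub>j\<close>, and hyperplanes for which these first steps are pairwise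
  different are independent (\<open>indep_if_flag_entry_inj\<close>).  So two factors of a dependent
  monomial have the same image, and the boundary of the monomial goes to zero.  If the hyperplanes
  of a monomial have no common point, one of them does not contain the point \<open>S\<^sub>n\<close>, and
  the image of its generator is zero.

  For the converse, call a set of indices nbc if it contains no broken circuit.  Modulo the ideal, the
  nbc monomials span the degree \<open>n\<close> part (\<open>nbc_monomials_span\<close>).  Every nbc set \<open>T\<close> of size \<open>n\<close>
  has a flag, given by the intersections of the \<open>k\<close> hyperplanes of largest index in \<open>T\<close>,
  whose homomorphism kills all nbc monomials of degree \<open>n\<close> except \<open>x\<^sub>T\<close> (\<open>nbc_dual_flag\<close>).
  So if all flags kill an element of degree \<open>n\<close>, all its coefficients with respect to nbc monomials vanish.
\<close>

section \<open>Linear algebra of families of complex vectors\<close>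

lemma fscale_apply: "fscale c f i = c * f i"
  by (simp add: fscale_def)

lemma sum_fun_apply: "sum F A x = (\<Sum>a\<in>A. F a x)" for F :: "'a \<Rightarrow> 'b \<Rightarrow> 'c::comm_monoid_add"
  by (induction A rule: infinite_finite_induct) auto

text \<open>Independence of a family, not of its image: a repeated vector makes the family dependent.\<close>
definition indep :: "('j \<Rightarrow> 'i \<Rightarrow> complex) \<Rightarrow> 'j set \<Rightarrow> bool"
  where "indep f A \<longleftrightarrow> inj_on f A \<and> \<not> cvec.dependent (f ` A)"

lemma indep_empty: "indep f {}"
  by (simp add: indep_def cvec.independent_empty)

lemma indep_insert:
  assumes "indep f A" "f a \<notin> cvec_span (f ` A)"
  shows "indep f (insert a A)"
proof -
  have "f a \<notin> f ` A"
    using assms(2) cvec.span_base[of "f a" "f ` A"] by (rule contrapos_nn)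
  then have "inj_on f (insert a A)"
    using assms(1) by (auto simp: indep_def)
  moreover have "\<not> cvec.dependent (insert (f a) (f ` A))"
    using assms by (intro cvec.independent_insertI) (simp_all add: indep_def)
  ultimately show ?thesis by (simp add: indep_def)
qed

lemma indep_dim: "indep f A \<Longrightarrow> cvec_dim (f ` A) = card A"
  unfolding indep_def by (simp add: cvec.dim_eq_card_independent card_image)

lemma indep_subset: "indep f A \<Longrightarrow> B \<subseteq> A \<Longrightarrow> indep f B"
  unfolding indep_def using cvec.dependent_mono[of "f ` B" "f ` A"] inj_on_subset by blast

lemma indep_not_in_span:
  assumes "indep f A" "a \<in> A" "B \<subseteq> A - {a}"
  shows "f a \<notin> cvec_span (f ` B)"
proof
  assume "f a \<in> cvec_span (f ` B)"
  moreover have "f ` B \<subseteq> f ` A - {f a}" using assms by (auto simp: indep_def inj_on_def)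
  ultimately have "f a \<in> cvec_span (f ` A - {f a})" using cvec.span_mono by blast
  then show False using assms(1,2) by (auto simp: indep_def cvec.dependent_def)
qed

lemma cvec_dim_empty: "cvec_dim ({} :: ('a \<Rightarrow> complex) set) = 0"
  using cvec.dim_le_card'[of "{}"] by simp

lemma dim_less_card_iff_not_indep:
  assumes "finite A"
  shows "cvec_dim (f ` A) < card A \<longleftrightarrow> \<not> indep f A"
proof
  assume "\<not> indep f A"
  show "cvec_dim (f ` A) < card A"
  proof (cases "inj_on f A")
    case False
    then have "card (f ` A) < card A"
      using card_image_le[OF assms, of f] eq_card_imp_inj_on[OF assms, of f] by linarith
    then show ?thesis using cvec.dim_le_card'[of "f ` A"] assms by simp
  next
    case True
    then have "cvec.dependent (f ` A)" using \<open>\<not> indep f A\<close> by (simp add: indep_def)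
    then obtain v where v: "v \<in> f ` A" "v \<in> cvec_span (f ` A - {v})"
      unfolding cvec.dependent_def by blast
    have "f ` A \<subseteq> cvec_span (f ` A - {v})"
    proof
      fix w assume "w \<in> f ` A"
      then show "w \<in> cvec_span (f ` A - {v})"
        using v(2) by (cases "w = v") (auto intro: cvec.span_base)
    qed
    then have "cvec_dim (f ` A) \<le> card (f ` A - {v})"
      by (rule cvec.dim_le_card) (use assms in simp)
    also have "\<dots> < card (f ` A)" using v(1) assms by (intro psubset_card_mono) auto
    also have "\<dots> \<le> card A" using assms card_image_le by blast
    finally show ?thesis .
  qed
qed (auto simp: indep_dim)

lemma not_indep_iff_relation:
  assumes "finite A"
  shows "\<not> indep f A \<longleftrightarrow> (\<exists>u. (\<exists>k\<in>A. u k \<noteq> 0) \<and> (\<Sum>k\<in>A. fscale (u k) (f k)) = 0)"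
proof (cases "inj_on f A")
  case True
  have "cvec.dependent (f ` A) \<longleftrightarrow>
      (\<exists>u. (\<exists>v\<in>f ` A. u v \<noteq> 0) \<and> (\<Sum>v\<in>f ` A. fscale (u v) v) = 0)"
    by (rule cvec.dependent_finite) (use assms in simp)
  also have "\<dots> \<longleftrightarrow> (\<exists>u. (\<exists>k\<in>A. u (f k) \<noteq> 0) \<and> (\<Sum>k\<in>A. fscale (u (f k)) (f k)) = 0)"
    by (simp add: sum.reindex[OF True])
  also have "\<dots> \<longleftrightarrow> (\<exists>u. (\<exists>k\<in>A. u k \<noteq> 0) \<and> (\<Sum>k\<in>A. fscale (u k) (f k)) = 0)" (is "?L \<longleftrightarrow> ?R")
  proof
    assume ?R
    then obtain u where u: "\<exists>k\<in>A. u k \<noteq> 0" "(\<Sum>k\<in>A. fscale (u k) (f k)) = 0" by blast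
    define g where "g = (\<lambda>v. u (the_inv_into A f v))"
    have inv: "g (f k) = u k" if "k \<in> A" for k
      using that True by (simp add: g_def the_inv_into_f_f)
    have "(\<Sum>k\<in>A. fscale (g (f k)) (f k)) = (\<Sum>k\<in>A. fscale (u k) (f k))"
      by (intro sum.cong refl) (simp add: inv)
    then have "(\<exists>k\<in>A. g (f k) \<noteq> 0) \<and> (\<Sum>k\<in>A. fscale (g (f k)) (f k)) = 0"
      using u inv by metis
    then show ?L by (rule exI[of _ g])
  next
    assume ?L
    then obtain u where u: "(\<exists>k\<in>A. u (f k) \<noteq> 0) \<and> (\<Sum>k\<in>A. fscale (u (f k)) (f k)) = 0" ..
    then show ?R by (rule exI[of _ "\<lambda>k. u (f k)"])
  qed
  finally show ?thesis using True by (simp add: indep_def)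
next
  case False
  then obtain i j where ij: "i \<in> A" "j \<in> A" "i \<noteq> j" "f i = f j" by (auto simp: inj_on_def)
  define u :: "'a \<Rightarrow> complex" where "u = (\<lambda>k. if k = i then 1 else if k = j then -1 else 0)"
  have "(\<Sum>k\<in>A. fscale (u k) (f k)) = (\<Sum>k\<in>{i, j}. fscale (u k) (f k))"
    by (rule sum.mono_neutral_right) (use assms ij in \<open>auto simp: u_def fscale_def\<close>)
  also have "\<dots> = 0" using ij by (auto simp: u_def fscale_def fun_eq_iff)
  finally have "(\<exists>k\<in>A. u k \<noteq> 0) \<and> (\<Sum>k\<in>A. fscale (u k) (f k)) = 0"
    using ij by (auto simp: u_def)
  then show ?thesis using False by (auto simp: indep_def)
qed

text \<open>The member of highest rank lies outside the span of all others, and the others are independent by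
  induction.\<close>
lemma indep_if_ranked:
  fixes d :: "'j \<Rightarrow> nat"
  assumes "finite S" "inj_on d S"
    and "\<And>s. s \<in> S \<Longrightarrow> f s \<notin> cvec_span (f ` {s' \<in> S. d s' < d s})"
  shows "indep f S"
  using assms
proof (induction S rule: finite_ranking_induct[where f = d])
  case empty
  show ?case by (rule indep_empty)
next
  case (insert s S)
  show ?case
  proof (cases "s \<in> S")
    case True
    with insert show ?thesis by (simp add: insert_absorb)
  next
    case False
    have less: "d s' < d s" if "s' \<in> S" for s'
    proof -
      have "d s' \<noteq> d s" using insert.prems(1) that False by (auto simp: inj_on_def)
      moreover have "d s' \<le> d s" by (rule insert.hyps(2)[OF that])
      ultimately show ?thesis by simp
    qed
    have "{s' \<in> insert s S. d s' < d s} = S" using less by auto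
    then have "f s \<notin> cvec_span (f ` S)" using insert.prems(2)[of s] by simp
    moreover have "indep f S"
    proof (rule insert.IH)
      show "inj_on d S" using insert.prems(1) by (simp add: inj_on_def)
      fix t assume t: "t \<in> S"
      have "{s' \<in> insert s S. d s' < d t} = {s' \<in> S. d s' < d t}" using less[OF t] by auto
      then show "f t \<notin> cvec_span (f ` {s' \<in> S. d s' < d t})"
        using insert.prems(2)[of t] t by simp
    qed
    ultimately show ?thesis by (intro indep_insert)
  qed
qed

lemma indep_spans_if_card:
  assumes "indep f A" "finite B" "f ` A \<subseteq> cvec_span (f ` B)" "card B \<le> card A"
  shows "cvec_span (f ` B) \<subseteq> cvec_span (f ` A)"
proof (rule ccontr)
  assume "\<not> ?thesis"
  then obtain v where v: "v \<in> cvec_span (f ` B)" "v \<notin> cvec_span (f ` A)" by blast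
  have "finite (insert v (f ` A)) \<and> card (insert v (f ` A)) \<le> card (f ` B)"
  proof (rule cvec.independent_span_bound)
    show "\<not> cvec.dependent (insert v (f ` A))"
      using assms(1) v(2) by (intro cvec.independent_insertI) (auto simp: indep_def)
  qed (use assms v in auto)
  moreover have "v \<notin> f ` A" using v(2) cvec.span_base[of v "f ` A"] by (rule contrapos_nn)
  moreover have "card (f ` A) = card A" using assms(1) by (simp add: indep_def card_image)
  ultimately show False using card_image_le[OF assms(2), of f] assms(4) by auto
qed


section \<open>Annihilators\<close>

definition annih :: "'i set \<Rightarrow> ('i \<Rightarrow> complex) set \<Rightarrow> ('i \<Rightarrow> complex) set"
  where "annih I C = {x \<in> coord_space I. \<forall>c\<in>C. (\<Sum>i\<in>I. c i * x i) = 0}"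

lemma coord_space_add: "f \<in> coord_space I \<Longrightarrow> g \<in> coord_space I \<Longrightarrow> f + g \<in> coord_space I"
  by (simp add: coord_space_def)

lemma coord_space_diff: "f \<in> coord_space I \<Longrightarrow> g \<in> coord_space I \<Longrightarrow> f - g \<in> coord_space I"
  by (simp add: coord_space_def)

lemma coord_space_scale: "f \<in> coord_space I \<Longrightarrow> fscale c f \<in> coord_space I"
  by (simp add: coord_space_def fscale_def)

lemma coord_space_zero: "0 \<in> coord_space I"
  by (simp add: coord_space_def)

lemma coord_space_sum: "(\<And>a. a \<in> A \<Longrightarrow> F a \<in> coord_space I) \<Longrightarrow> sum F A \<in> coord_space I"
  by (simp add: coord_space_def sum_fun_apply)

lemma subspace_annih: "cvec.subspace (annih I C)"
  unfolding cvec.subspace_def annih_def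
proof (intro conjI ballI allI)
  fix a :: complex and x assume x: "x \<in> {x \<in> coord_space I. \<forall>c\<in>C. (\<Sum>i\<in>I. c i * x i) = 0}"
  have "(\<Sum>i\<in>I. c i * fscale a x i) = a * (\<Sum>i\<in>I. c i * x i)" for c
    by (simp add: fscale_def sum_distrib_left mult.left_commute)
  then show "fscale a x \<in> {x \<in> coord_space I. \<forall>c\<in>C. (\<Sum>i\<in>I. c i * x i) = 0}"
    using x by (simp add: coord_space_scale)
qed (auto simp: coord_space_add coord_space_zero distrib_left sum.distrib)

definition coord_vec :: "'i \<Rightarrow> 'i \<Rightarrow> complex"
  where "coord_vec i = (\<lambda>j. if j = i then 1 else 0)"

lemma coord_space_expand:
  assumes "finite I" "x \<in> coord_space I"
  shows "x = (\<Sum>i\<in>I. fscale (x i) (coord_vec i))"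
proof
  fix j
  have "(\<Sum>i\<in>I. fscale (x i) (coord_vec i)) j = (\<Sum>i\<in>I. if j = i then x j else 0)"
    unfolding sum_fun_apply by (intro sum.cong) (auto simp: fscale_def coord_vec_def)
  also have "\<dots> = x j" using assms by (auto simp: coord_space_def)
  finally show "x j = (\<Sum>i\<in>I. fscale (x i) (coord_vec i)) j" by simp
qed

lemma coord_space_subset_span: "finite I \<Longrightarrow> coord_space I \<subseteq> cvec_span (coord_vec ` I)"
proof
  fix x :: "'a \<Rightarrow> complex"
  assume I: "finite I" "x \<in> coord_space I"
  have "(\<Sum>i\<in>I. fscale (x i) (coord_vec i)) \<in> cvec_span (coord_vec ` I)"
    by (intro cvec.span_sum cvec.span_scale cvec.span_base) auto
  then show "x \<in> cvec_span (coord_vec ` I)" using coord_space_expand[OF I] by simp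
qed

lemma indep_coord_vec:
  assumes "finite I"
  shows "indep coord_vec I"
proof (rule ccontr)
  assume "\<not> indep coord_vec I"
  then obtain u k where "k \<in> I" "u k \<noteq> 0" "(\<Sum>k\<in>I. fscale (u k) (coord_vec k)) = 0"
    using not_indep_iff_relation[OF assms] by blast
  moreover have "(\<Sum>k\<in>I. fscale (u k) (coord_vec k)) k = (\<Sum>i\<in>I. if k = i then u k else 0)"
    unfolding sum_fun_apply by (intro sum.cong) (auto simp: fscale_def coord_vec_def)
  ultimately show False using assms by simp
qed

lemma dim_coord_space:
  assumes "finite I"
  shows "cvec_dim (coord_space I) = card I"
proof (rule cvec.dim_unique)
  show "coord_vec ` I \<subseteq> coord_space I" by (auto simp: coord_space_def coord_vec_def)
  show "coord_space I \<subseteq> cvec_span (coord_vec ` I)" by (rule coord_space_subset_span[OF assms])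
qed (use indep_coord_vec[OF assms] in \<open>auto simp: indep_def card_image\<close>)

text \<open>Induction on \<open>C\<close>.  If the new vector \<open>d\<close> does not vanish on the annihilator of the others, there is a
  \<open>u\<close> in that annihilator with \<open>d(u) = 1\<close>, and subtracting \<open>c(u) d\<close> from \<open>c\<close> gives a form that vanishes
  on the whole annihilator of the others.\<close>
lemma double_annihilator:
  assumes "finite I" "finite C" "C \<subseteq> coord_space I" "c \<in> coord_space I"
    and "\<And>x. x \<in> annih I C \<Longrightarrow> (\<Sum>i\<in>I. c i * x i) = 0"
  shows "c \<in> cvec_span C"
  using assms(2-5)
proof (induction C arbitrary: c rule: finite_induct)
  case empty
  have "c i = 0" for i
  proof (cases "i \<in> I")
    case True
    have "(\<Sum>j\<in>I. c j * coord_vec i j) = (\<Sum>j\<in>I. if j = i then c i else 0)"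
      by (intro sum.cong) (auto simp: coord_vec_def)
    moreover have "coord_vec i \<in> annih I {}"
      using True by (auto simp: annih_def coord_space_def coord_vec_def)
    ultimately show ?thesis using empty(3)[of "coord_vec i"] assms(1) True by simp
  qed (use empty in \<open>simp add: coord_space_def\<close>)
  then have c0: "c = 0" by (intro ext) (metis zero_fun_apply)
  show ?case unfolding c0 by (rule cvec.span_zero)
next
  case (insert d C)
  show ?case
  proof (cases "\<forall>x\<in>annih I C. (\<Sum>i\<in>I. d i * x i) = 0")
    case True
    then have "annih I C = annih I (insert d C)" by (auto simp: annih_def)
    then have "c \<in> cvec_span C" using insert by auto
    then show ?thesis using cvec.span_mono[of C "insert d C"] by auto
  next
    case False
    then obtain u0 where u0: "u0 \<in> annih I C" "(\<Sum>i\<in>I. d i * u0 i) \<noteq> 0" by blast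
    define u where "u = fscale (inverse (\<Sum>i\<in>I. d i * u0 i)) u0"
    have u: "u \<in> annih I C" unfolding u_def by (intro cvec.subspace_scale subspace_annih u0)
    have "(\<Sum>i\<in>I. d i * u i) = inverse (\<Sum>i\<in>I. d i * u0 i) * (\<Sum>i\<in>I. d i * u0 i)"
      unfolding u_def fscale_def by (simp add: sum_distrib_left mult.left_commute)
    then have du: "(\<Sum>i\<in>I. d i * u i) = 1" using u0(2) by simp
    define cu where "cu = (\<Sum>i\<in>I. c i * u i)"
    have "c - fscale cu d \<in> cvec_span C"
    proof (rule insert.IH)
      show "C \<subseteq> coord_space I" using insert.prems by simp
      show "c - fscale cu d \<in> coord_space I"
        using insert.prems by (intro coord_space_diff coord_space_scale) auto
      fix x assume x: "x \<in> annih I C"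
      define dx where "dx = (\<Sum>i\<in>I. d i * x i)"
      have A: "x - fscale dx u \<in> annih I C"
        by (intro cvec.subspace_diff cvec.subspace_scale subspace_annih x u)
      have lin: "(\<Sum>i\<in>I. e i * (x - fscale dx u) i) = (\<Sum>i\<in>I. e i * x i) - dx * (\<Sum>i\<in>I. e i * u i)" for e
        by (simp add: fscale_def algebra_simps sum_subtractf sum_distrib_left)
      have "x - fscale dx u \<in> annih I (insert d C)"
        using A lin[of d] du by (simp add: annih_def dx_def)
      then have "(\<Sum>i\<in>I. c i * x i) = dx * cu"
        using insert.prems(3)[of "x - fscale dx u"] lin[of c] unfolding cu_def by (simp only: diff_eq_eq) simp
      moreover have "(\<Sum>i\<in>I. (c - fscale cu d) i * x i) = (\<Sum>i\<in>I. c i * x i) - cu * dx"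
        by (simp add: fscale_def algebra_simps sum_subtractf sum_distrib_left dx_def)
      ultimately show "(\<Sum>i\<in>I. (c - fscale cu d) i * x i) = 0" by simp
    qed
    then have "c - fscale cu d \<in> cvec_span (insert d C)"
      using cvec.span_mono[of C "insert d C"] by auto
    moreover have "fscale cu d \<in> cvec_span (insert d C)"
      by (intro cvec.span_scale cvec.span_base) simp
    ultimately have "(c - fscale cu d) + fscale cu d \<in> cvec_span (insert d C)"
      by (rule cvec.span_add)
    then show ?thesis by simp
  qed
qed

text \<open>A vector outside the span of \<open>C\<close> lowers the dimension of the annihilator by exactly one, since by
  \<open>double_annihilator\<close> it takes a nonzero value at some point \<open>u\<close> of the annihilator of \<open>C\<close>.\<close>
lemma dim_annih:
  assumes "finite I" "finite C" "C \<subseteq> coord_space I"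
  shows "cvec_dim (annih I C) + cvec_dim C = card I"
  using assms(2,3)
proof (induction C rule: finite_induct)
  case empty
  have "cvec_dim ({} :: ('a \<Rightarrow> complex) set) = 0"
    using cvec.dim_le_card'[of "{}"] by simp
  moreover have "annih I {} = coord_space I" by (simp add: annih_def)
  ultimately show ?case using dim_coord_space[OF assms(1)] by simp
next
  case (insert d C)
  show ?case
  proof (cases "d \<in> cvec_span C")
    case True
    have "annih I C \<subseteq> annih I (insert d C)"
    proof
      fix x assume x: "x \<in> annih I C"
      have "cvec.subspace {e. (\<Sum>i\<in>I. e i * x i) = 0}"
        unfolding cvec.subspace_def
        by (auto simp: fscale_def distrib_right sum.distrib sum_distrib_left[symmetric] mult.assoc)
      moreover have "C \<subseteq> {e. (\<Sum>i\<in>I. e i * x i) = 0}" using x by (auto simp: annih_def)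
      ultimately have "cvec_span C \<subseteq> {e. (\<Sum>i\<in>I. e i * x i) = 0}" by (intro cvec.span_minimal)
      then show "x \<in> annih I (insert d C)" using True x by (auto simp: annih_def)
    qed
    then have "annih I (insert d C) = annih I C" by (auto simp: annih_def)
    moreover have "cvec_dim (insert d C) = cvec_dim C"
      using cvec.span_redundant[OF True] by (intro cvec.span_eq_dim)
    ultimately show ?thesis using insert by simp
  next
    case False
    obtain u where u: "u \<in> annih I C" "(\<Sum>i\<in>I. d i * u i) \<noteq> 0"
      using double_annihilator[OF assms(1) insert.hyps(1), of d] insert.prems False by auto
    obtain B where B: "B \<subseteq> annih I (insert d C)" "\<not> cvec.dependent B"
        "annih I (insert d C) \<subseteq> cvec_span B" "card B = cvec_dim (annih I (insert d C))"
      by (rule cvec.basis_exists)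
    have spanB: "cvec_span B \<subseteq> annih I (insert d C)"
      by (rule cvec.span_minimal[OF B(1) subspace_annih])
    have uB: "u \<notin> cvec_span B" using u(2) spanB by (auto simp: annih_def)
    have "B \<subseteq> cvec_span (coord_vec ` I)"
      using B(1) coord_space_subset_span[OF assms(1)] by (auto simp: annih_def)
    then have finB: "finite B"
      using cvec.independent_span_bound[OF _ B(2)] assms(1) by blast
    have "cvec_dim (annih I C) = Suc (card B)"
    proof (rule cvec.dim_unique)
      show "insert u B \<subseteq> annih I C" using u(1) B(1) by (auto simp: annih_def)
      show "\<not> cvec.dependent (insert u B)" using B(2) uB by (intro cvec.independent_insertI)
      have "u \<notin> B" using uB cvec.span_base[of u B] by (rule contrapos_nn)
      then show "card (insert u B) = Suc (card B)" using finB by simp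
      show "annih I C \<subseteq> cvec_span (insert u B)"
      proof
        fix x assume x: "x \<in> annih I C"
        define r where "r = (\<Sum>i\<in>I. d i * x i) / (\<Sum>i\<in>I. d i * u i)"
        have "x - fscale r u \<in> annih I C"
          by (intro cvec.subspace_diff cvec.subspace_scale subspace_annih x u)
        moreover have "(\<Sum>i\<in>I. d i * (x - fscale r u) i) = (\<Sum>i\<in>I. d i * x i) - r * (\<Sum>i\<in>I. d i * u i)"
          by (simp add: fscale_def algebra_simps sum_subtractf sum_distrib_left)
        ultimately have "x - fscale r u \<in> annih I (insert d C)"
          using u(2) by (simp add: annih_def r_def)
        then have "x - fscale r u \<in> cvec_span (insert u B)"
          using B(3) cvec.span_mono[of B "insert u B"] by auto
        moreover have "fscale r u \<in> cvec_span (insert u B)"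
          by (intro cvec.span_scale cvec.span_base) simp
        ultimately have "(x - fscale r u) + fscale r u \<in> cvec_span (insert u B)"
          by (rule cvec.span_add)
        then show "x \<in> cvec_span (insert u B)" by simp
      qed
    qed
    moreover have "cvec_dim (insert d C) = Suc (cvec_dim C)"
    proof -
      obtain B' where B': "B' \<subseteq> C" "\<not> cvec.dependent B'" "C \<subseteq> cvec_span B'" "card B' = cvec_dim C"
        by (rule cvec.basis_exists)
      have d: "d \<notin> cvec_span B'" using False cvec.span_mono[OF B'(1)] by auto
      then have "d \<notin> B'" using cvec.span_base[of d B'] by (rule contrapos_nn)
      moreover have "finite B'" using B'(1) insert.hyps(1) finite_subset by blast
      moreover have "insert d C \<subseteq> cvec_span (insert d B')"
        using B'(3) cvec.span_mono[of B' "insert d B'"] cvec.span_base[of d "insert d B'"] by auto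
      ultimately show ?thesis
        using B' d by (intro cvec.dim_unique[of "insert d B'"] cvec.independent_insertI) auto
    qed
    ultimately show ?thesis using insert B(4) by simp
  qed
qed


declare One_nat_def [simp del]

section \<open>Bilinearity and expansion in the exterior algebra\<close>

lemma wedge_fscale_left: "wedge (fscale c f) g = fscale c (wedge f g)"
  by (simp add: wedge_def fscale_def sum_distrib_left mult_ac)

lemma wedge_fscale_right: "wedge f (fscale c g) = fscale c (wedge f g)"
  by (simp add: wedge_def fscale_def sum_distrib_left mult_ac)

lemma wedge_zero_left: "wedge 0 g = 0"
  by (simp add: wedge_def fun_eq_iff)

lemma wedge_zero_right: "wedge f 0 = 0"
  by (simp add: wedge_def fun_eq_iff)

lemma wedge_minus_left: "wedge (- f) g = - wedge f g"
  by (simp add: wedge_def fun_eq_iff sum_negf)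

lemma wedge_sum_left: "wedge (sum F A) g = (\<Sum>a\<in>A. wedge (F a) g)"
  by (induction A rule: infinite_finite_induct) 
    (simp_all add: wedge_zero_left wedge_add_left del: zero_fun_apply plus_fun_apply)

lemma wedge_sum_right: "wedge f (sum F A) = (\<Sum>a\<in>A. wedge f (F a))"
  by (induction A rule: infinite_finite_induct) 
    (simp_all add: wedge_zero_right wedge_add_right del: zero_fun_apply plus_fun_apply)

lemma ext_monom_in_carrier: "T \<subseteq> {1..l} \<Longrightarrow> ext_monom T \<in> coord_space (Pow {1..l})"
  by (auto simp: coord_space_def ext_monom_def)

lemma gen_in_carrier: "i \<in> {1..l} \<Longrightarrow> gen i \<in> coord_space (Pow {1..l})"
  by (simp add: gen_def ext_monom_in_carrier)

lemma linear_elem_in_carrier: "linear_elem l c \<in> coord_space (Pow {1..l})"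
  unfolding linear_elem_def
  by (intro coord_space_sum coord_space_scale gen_in_carrier)

lemma wedge_list_Nil: "wedge_list [] = ext_monom {}"
  by (simp add: wedge_list_def)

lemma wedge_list_Cons: "wedge_list (w # ws) = wedge w (wedge_list ws)"
  by (simp add: wedge_list_def)

lemma wedge_list_in_carrier:
  "set ws \<subseteq> coord_space (Pow {1..l}) \<Longrightarrow> wedge_list ws \<in> coord_space (Pow {1..l})"
  by (induction ws)
    (auto simp: wedge_list_Nil wedge_list_Cons intro: ext_monom_in_carrier wedge_closed)

lemma wedge_list_append:
  assumes "set vs \<subseteq> coord_space (Pow {1..l})"
  shows "wedge_list (us @ vs) = wedge (wedge_list us) (wedge_list vs)"
  by (induction us)
    (simp_all add: wedge_list_Nil wedge_list_Cons wedge_assoc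
      wedge_one_left[OF wedge_list_in_carrier[OF assms]])

lemma gens_Nil: "gens [] = ext_monom {}"
  by (simp add: gens_def wedge_list_Nil)

lemma gens_Cons: "gens (i # is) = wedge (gen i) (gens is)"
  by (simp add: gens_def wedge_list_Cons)

lemma gens_in_carrier: "set is \<subseteq> {1..l} \<Longrightarrow> gens is \<in> coord_space (Pow {1..l})"
  unfolding gens_def by (rule wedge_list_in_carrier) (auto intro!: gen_in_carrier)

lemma gens_append:
  assumes "set js \<subseteq> {1..l}"
  shows "gens (is @ js) = wedge (gens is) (gens js)"
  unfolding gens_def map_append
  by (rule wedge_list_append[of _ l]) (use assms in \<open>auto intro!: gen_in_carrier\<close>)

lemma boundary_in_carrier: "set is \<subseteq> {1..l} \<Longrightarrow> boundary is \<in> coord_space (Pow {1..l})"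
  unfolding boundary_def
  by (intro coord_space_sum coord_space_scale gens_in_carrier)
    (auto dest: in_set_takeD in_set_dropD)

text \<open>The scalar is the sign of the sorting permutation, which the proof of the theorem never needs
  to know.\<close>
lemma gens_eq_scaled_monom:
  "gens is = 0 \<or> (distinct is \<and> (\<exists>a. gens is = fscale a (ext_monom (set is))))"
proof (induction "is")
  case Nil
  show ?case by (auto simp: gens_Nil fscale_def intro: exI[of _ 1])
next
  case (Cons i "is")
  show ?case
  proof (cases "gens is = 0")
    case True
    then show ?thesis by (simp add: gens_Cons wedge_zero_right)
  next
    case False
    then obtain a where a: "distinct is" "gens is = fscale a (ext_monom (set is))"
      using Cons.IH by blast
    have g: "gens (i # is) = fscale a (wedge (ext_monom {i}) (ext_monom (set is)))"
      by (simp add: gens_Cons a(2) wedge_fscale_right gen_def)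
    show ?thesis
    proof (cases "i \<in> set is")
      case True
      then have "gens (i # is) = 0" by (simp add: g wedge_monom)
      then show ?thesis ..
    next
      case False
      then have "gens (i # is) =
          fscale (a * (-1) ^ inversions {i} (set is)) (ext_monom (set (i # is)))"
        by (simp add: g wedge_monom fscale_def mult.assoc)
      then show ?thesis using False a(1) by auto
    qed
  qed
qed

lemma ext_expand:
  assumes "f \<in> coord_space (Pow {1..l})"
  shows "f = (\<Sum>T\<in>Pow {1..l}. fscale (f T) (ext_monom T))"
proof -
  have "coord_vec = ext_monom" by (simp add: coord_vec_def ext_monom_def fun_eq_iff)
  then show ?thesis using coord_space_expand[OF _ assms] by simp
qed

lemma wedge_linear_elem:
  "wedge (linear_elem m u) (linear_elem m v) =
    (\<Sum>i=1..m. \<Sum>j=1..m. fscale (u i * v j) (wedge (gen i) (gen j)))"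
proof -
  have "wedge (linear_elem m u) (linear_elem m v) =
      (\<Sum>j=1..m. \<Sum>i=1..m. fscale (v j * u i) (wedge (gen i) (gen j)))"
    unfolding linear_elem_def
    by (simp only: wedge_sum_left wedge_sum_right wedge_fscale_left wedge_fscale_right
        cvec.scale_sum_right cvec.scale_scale)
  then show ?thesis by (subst sum.swap) (simp only: mult.commute)
qed

lemma linear_elem_anticomm:
  "wedge (linear_elem m u) (linear_elem m v) = - wedge (linear_elem m v) (linear_elem m u)"
proof -
  have "wedge (linear_elem m u) (linear_elem m v) =
      (\<Sum>i=1..m. \<Sum>j=1..m. fscale (u i * v j) (wedge (gen i) (gen j)))"
    by (rule wedge_linear_elem)
  also have "\<dots> = (\<Sum>j=1..m. \<Sum>i=1..m. fscale (u i * v j) (wedge (gen i) (gen j)))"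
    by (rule sum.swap)
  also have "\<dots> = (\<Sum>j=1..m. \<Sum>i=1..m. - fscale (v j * u i) (wedge (gen j) (gen i)))"
    by (intro sum.cong refl, subst gen_anticomm) (simp add: fscale_def fun_eq_iff mult_ac)
  also have "\<dots> = - (\<Sum>j=1..m. \<Sum>i=1..m. fscale (v j * u i) (wedge (gen j) (gen i)))"
    by (simp add: sum_negf)
  also have "(\<Sum>j=1..m. \<Sum>i=1..m. fscale (v j * u i) (wedge (gen j) (gen i))) =
      wedge (linear_elem m v) (linear_elem m u)"
    by (rule wedge_linear_elem[symmetric])
  finally show ?thesis .
qed

lemma sum_linear_elem:
  "(\<Sum>j\<in>J. fscale (c j) (linear_elem m (u j))) = linear_elem m (\<lambda>k. \<Sum>j\<in>J. c j * u j k)"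
proof -
  have "(\<Sum>j\<in>J. fscale (c j) (linear_elem m (u j))) =
      (\<Sum>j\<in>J. \<Sum>k=1..m. fscale (c j * u j k) (gen k))"
    unfolding linear_elem_def by (simp add: cvec.scale_sum_right)
  also have "\<dots> = (\<Sum>k=1..m. \<Sum>j\<in>J. fscale (c j * u j k) (gen k))" by (rule sum.swap)
  also have "\<dots> = linear_elem m (\<lambda>k. \<Sum>j\<in>J. c j * u j k)"
    unfolding linear_elem_def by (simp add: cvec.scale_sum_left)
  finally show ?thesis .
qed


section \<open>Homomorphisms between exterior algebras\<close>

text \<open>The algebra homomorphism with \<open>x\<^sub>j \<mapsto> y\<^sub>j\<close>, as the linear map with the prescribed values on the
  monomials.  It is multiplicative only for anticommuting \<open>y\<^sub>j\<close>.\<close>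
definition ext_lift :: "nat \<Rightarrow> (nat \<Rightarrow> ext) \<Rightarrow> ext \<Rightarrow> ext"
  where "ext_lift l y f =
    (\<Sum>T\<in>Pow {1..l}. fscale (f T) (wedge_list (map y (sorted_list_of_set T))))"

lemma ext_lift_add: "ext_lift l y (f + g) = ext_lift l y f + ext_lift l y g"
  by (simp add: ext_lift_def cvec.scale_left_distrib sum.distrib)

lemma ext_lift_scale: "ext_lift l y (fscale c f) = fscale c (ext_lift l y f)"
  by (simp add: ext_lift_def cvec.scale_sum_right fscale_apply)

lemma ext_lift_zero: "ext_lift l y 0 = 0"
  by (simp add: ext_lift_def)

lemma ext_lift_minus: "ext_lift l y (- f) = - ext_lift l y f"
  by (simp add: ext_lift_def cvec.scale_minus_left sum_negf)

lemma ext_lift_sum: "ext_lift l y (sum F A) = (\<Sum>a\<in>A. ext_lift l y (F a))"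
  by (induction A rule: infinite_finite_induct) 
    (simp_all add: ext_lift_zero ext_lift_add del: zero_fun_apply plus_fun_apply)

lemma ext_lift_monom:
  assumes "T \<subseteq> {1..l}"
  shows "ext_lift l y (ext_monom T) = wedge_list (map y (sorted_list_of_set T))"
proof -
  have "ext_lift l y (ext_monom T) =
      (\<Sum>U\<in>Pow {1..l}. if U = T then wedge_list (map y (sorted_list_of_set T)) else 0)"
    unfolding ext_lift_def by (intro sum.cong refl) (auto simp: ext_monom_def)
  then show ?thesis using assms by simp
qed

lemma ext_lift_sorted_gens:
  assumes "sorted_wrt (<) is" "set is \<subseteq> {1..l}"
  shows "ext_lift l y (gens is) = wedge_list (map y is)"
proof -
  have "sorted_list_of_set (set is) = is"
    using assms(1) by (intro sorted_list_of_set.idem_if_sorted_distinct)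
      (auto simp: strict_sorted_iff)
  then show ?thesis using assms by (simp add: gens_sorted ext_lift_monom)
qed

locale anticommuting =
  fixes y :: "nat \<Rightarrow> ext" and m :: nat
  assumes anticomm: "wedge (y i) (y j) = - wedge (y j) (y i)"
    and in_carrier: "y i \<in> coord_space (Pow {1..m})"
begin

lemma square_zero: "wedge (y i) (y i) = 0"
proof -
  have "wedge (y i) (y i) S = 0" for S
    using fun_cong[OF anticomm[of i i], of S] by simp
  then show ?thesis by (simp add: fun_eq_iff)
qed

lemma wedge_list_closed: "wedge_list (map y is) \<in> coord_space (Pow {1..m})"
  by (rule wedge_list_in_carrier) (use in_carrier in auto)

lemma ext_lift_closed: "ext_lift l y f \<in> coord_space (Pow {1..m})"
  unfolding ext_lift_def by (intro coord_space_sum coord_space_scale wedge_list_closed)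

text \<open>This is where multiplicativity comes from: while \<open>x\<^sub>i\<close> moves to its place in a
  sorted monomial, the images anticommute in the same way as the generators do.\<close>
lemma ext_lift_gen_sorted:
  assumes "sorted_wrt (<) ts" "set ts \<subseteq> {1..l}" "i \<in> {1..l}"
  shows "ext_lift l y (gens (i # ts)) = wedge (y i) (wedge_list (map y ts))"
  using assms
proof (induction ts)
  case Nil
  then show ?case using ext_lift_sorted_gens[of "[i]" l y] by (simp add: wedge_list_Cons)
next
  case (Cons t ts)
  have sq: "wedge (gen t) (wedge (gen t) f) = 0" "wedge (y t) (wedge (y t) f) = 0" for f t
    by (simp_all add: wedge_assoc[symmetric] gen_sq square_zero wedge_zero_left)
  consider "i < t" | "i = t" | "t < i" by linarith
  then show ?case
  proof cases
    case 1
    then have "sorted_wrt (<) (i # t # ts)" using Cons.prems by auto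
    then show ?thesis
      using ext_lift_sorted_gens[of "i # t # ts" l y] Cons.prems by (simp add: wedge_list_Cons)
  next
    case 2
    then show ?thesis by (simp add: gens_Cons wedge_list_Cons sq ext_lift_zero del: zero_fun_apply)
  next
    case 3
    have IH: "ext_lift l y (gens (i # ts)) = wedge (y i) (wedge_list (map y ts))"
      using Cons by simp
    have swap: "gens (i # t # ts) = - wedge (gen t) (gens (i # ts))"
      unfolding gens_Cons wedge_assoc[symmetric]
      by (subst gen_anticomm) (rule wedge_minus_left)
    have "ext_lift l y (wedge (gen t) (gens (i # ts))) = wedge (y t) (ext_lift l y (gens (i # ts)))"
    proof (cases "gens (i # ts) = 0")
      case True
      then show ?thesis by (simp add: wedge_zero_right ext_lift_zero)
    next
      case False
      then obtain a where a: "gens (i # ts) = fscale a (ext_monom (set (i # ts)))"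
        using gens_eq_scaled_monom[of "i # ts"] by blast
      define us where "us = sorted_list_of_set (set (i # ts))"
      have us: "sorted_wrt (<) us" "set us = set (i # ts)"
        by (simp_all add: us_def del: set_simps sorted_list_of_set_insert_remove)
      have tus: "sorted_wrt (<) (t # us)" using us 3 Cons.prems(1) by auto
      have m: "ext_monom (set (i # ts)) = gens us" using us by (simp add: gens_sorted)
      have "ext_lift l y (wedge (gen t) (gens us)) = wedge (y t) (ext_lift l y (gens us))"
        using ext_lift_sorted_gens[OF tus, of l y] ext_lift_sorted_gens[OF us(1), of l y] us(2)
          Cons.prems by (simp add: gens_Cons wedge_list_Cons)
      then show ?thesis unfolding a m by (simp add: wedge_fscale_right ext_lift_scale)
    qed
    then show ?thesis
      by (simp only: swap IH ext_lift_minus wedge_list_Cons list.map wedge_assoc[symmetric]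
          anticomm[of i t] wedge_minus_left)
  qed
qed

lemma ext_lift_gen_wedge:
  assumes "i \<in> {1..l}" "f \<in> coord_space (Pow {1..l})"
  shows "ext_lift l y (wedge (gen i) f) = wedge (y i) (ext_lift l y f)"
proof -
  have monom: "ext_lift l y (wedge (gen i) (ext_monom T)) = wedge (y i) (ext_lift l y (ext_monom T))"
    if "T \<in> Pow {1..l}" for T
  proof -
    have fin: "finite T" using that finite_subset by blast
    define ts where "ts = sorted_list_of_set T"
    have ts: "sorted_wrt (<) ts" "set ts = T" using fin by (simp_all add: ts_def)
    show ?thesis
      using ext_lift_gen_sorted[OF ts(1), of l i] ext_lift_sorted_gens[OF ts(1), of l y]
        gens_sorted[OF ts(1)] that assms(1) ts(2) by (simp add: gens_Cons)
  qed
  have "wedge (gen i) f = (\<Sum>T\<in>Pow {1..l}. fscale (f T) (wedge (gen i) (ext_monom T)))"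
    by (subst ext_expand[OF assms(2)]) (simp add: wedge_sum_right wedge_fscale_right)
  then have "ext_lift l y (wedge (gen i) f) =
      (\<Sum>T\<in>Pow {1..l}. fscale (f T) (wedge (y i) (ext_lift l y (ext_monom T))))"
    by (simp add: ext_lift_sum ext_lift_scale monom)
  also have "\<dots> = wedge (y i) (ext_lift l y (\<Sum>T\<in>Pow {1..l}. fscale (f T) (ext_monom T)))"
    by (simp add: ext_lift_sum ext_lift_scale wedge_sum_right wedge_fscale_right)
  also have "\<dots> = wedge (y i) (ext_lift l y f)" using ext_expand[OF assms(2)] by simp
  finally show ?thesis .
qed

lemma ext_lift_gens:
  "set is \<subseteq> {1..l} \<Longrightarrow> ext_lift l y (gens is) = wedge_list (map y is)"
proof (induction "is")
  case Nil
  show ?case using ext_lift_sorted_gens[of "[]" l y] by simp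
next
  case (Cons i "is")
  then show ?case
    using ext_lift_gen_wedge[OF _ gens_in_carrier, of i l "is"] by (simp add: gens_Cons wedge_list_Cons)
qed

lemma ext_lift_wedge:
  assumes "f \<in> coord_space (Pow {1..l})" "g \<in> coord_space (Pow {1..l})"
  shows "ext_lift l y (wedge f g) = wedge (ext_lift l y f) (ext_lift l y g)"
proof -
  have gens: "ext_lift l y (wedge (gens is) g) = wedge (ext_lift l y (gens is)) (ext_lift l y g)"
    if "set is \<subseteq> {1..l}" for "is"
    using that
  proof (induction "is")
    case Nil
    have "ext_lift l y (gens []) = ext_monom {}"
      using ext_lift_gens[of "[]" l] by (simp add: wedge_list_Nil)
    then show ?case
      by (simp add: gens_Nil wedge_one_left[OF assms(2)] wedge_one_left[OF ext_lift_closed])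
  next
    case (Cons i "is")
    then have "gens is \<in> coord_space (Pow {1..l})" by (intro gens_in_carrier) simp
    then show ?case
      using Cons assms(2)
      by (simp add: gens_Cons wedge_assoc ext_lift_gen_wedge[OF _ wedge_closed] ext_lift_gen_wedge)
  qed
  have monom: "ext_lift l y (wedge (ext_monom T) g) = wedge (ext_lift l y (ext_monom T)) (ext_lift l y g)"
    if "T \<in> Pow {1..l}" for T
  proof -
    have fin: "finite T" using that finite_subset by blast
    then have "gens (sorted_list_of_set T) = ext_monom T" by (simp add: gens_sorted)
    then show ?thesis using gens[of "sorted_list_of_set T"] fin that by simp
  qed
  have "ext_lift l y (wedge f g) =
      (\<Sum>T\<in>Pow {1..l}. fscale (f T) (wedge (ext_lift l y (ext_monom T)) (ext_lift l y g)))"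
    by (subst ext_expand[OF assms(1)])
      (simp add: wedge_sum_left wedge_fscale_left ext_lift_sum ext_lift_scale monom)
  also have "\<dots> = wedge (ext_lift l y (\<Sum>T\<in>Pow {1..l}. fscale (f T) (ext_monom T))) (ext_lift l y g)"
    by (simp add: ext_lift_sum ext_lift_scale wedge_sum_left wedge_fscale_left)
  also have "\<dots> = wedge (ext_lift l y f) (ext_lift l y g)" using ext_expand[OF assms(1)] by simp
  finally show ?thesis .
qed

lemma ext_lift_wedge_list:
  "set ws \<subseteq> coord_space (Pow {1..l}) \<Longrightarrow>
    ext_lift l y (wedge_list ws) = wedge_list (map (ext_lift l y) ws)"
proof (induction ws)
  case Nil
  show ?case using ext_lift_sorted_gens[of "[]" l y] by (simp add: wedge_list_Nil gens_Nil)
next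
  case (Cons w ws)
  then show ?case by (simp add: wedge_list_Cons ext_lift_wedge[OF _ wedge_list_in_carrier])
qed

lemma ext_lift_linear_elem: "ext_lift l y (linear_elem l c) = (\<Sum>j=1..l. fscale (c j) (y j))"
proof -
  have "ext_lift l y (gen j) = y j" if "j \<in> {1..l}" for j
    using ext_lift_gens[of "[j]" l] that
    by (simp add: gens_Cons gens_Nil wedge_list_Cons wedge_list_Nil
        wedge_one_right[OF gen_in_carrier[OF that]] wedge_one_right[OF in_carrier])
  then show ?thesis unfolding linear_elem_def by (simp add: ext_lift_sum ext_lift_scale)
qed

lemma wedge_list_pull:
  "wedge_list (map y (bs @ s # cs)) = fscale ((-1) ^ length bs) (wedge_list (map y (s # bs @ cs)))"
proof (induction bs)
  case (Cons b bs)
  have "wedge_list (map y ((b # bs) @ s # cs)) =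
      fscale ((-1) ^ length bs) (wedge (y b) (wedge (y s) (wedge_list (map y (bs @ cs)))))"
    using Cons by (simp add: wedge_list_Cons wedge_fscale_right)
  also have "\<dots> = fscale ((-1) ^ length (b # bs)) (wedge_list (map y (s # (b # bs) @ cs)))"
    unfolding wedge_assoc[symmetric] anticomm[of b s]
    by (simp add: wedge_list_Cons wedge_minus_left wedge_assoc fscale_def fun_eq_iff)
  finally show ?case .
qed (simp add: fscale_def)

lemma wedge_list_repeated:
  assumes "y s = y s'"
  shows "wedge_list (map y (as @ s # bs @ s' # cs)) = 0"
proof -
  have "wedge_list (map y (s # bs @ s' # cs)) =
      fscale ((-1) ^ length bs) (wedge (y s) (wedge (y s') (wedge_list (map y (bs @ cs)))))"
    using wedge_list_pull[of bs s' cs] by (simp add: wedge_list_Cons wedge_fscale_right)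
  also have "\<dots> = 0"
    by (simp add: assms wedge_assoc[symmetric] square_zero wedge_zero_left)
  finally show ?thesis
    by (induction as) (simp_all add: wedge_list_Cons wedge_zero_right)
qed

lemma wedge_list_zero_factor:
  "s \<in> set is \<Longrightarrow> y s = 0 \<Longrightarrow> wedge_list (map y is) = 0"
  by (induction "is") (auto simp: wedge_list_Cons wedge_zero_left wedge_zero_right)

text \<open>In the boundary only the two terms that omit one of the equal factors survive, and these
  differ by moving that factor past everything in between.\<close>

lemma boundary_vanishes_if_repeated:
  assumes "set is \<subseteq> {1..l}" "is = as @ s # bs @ s' # cs" "y s = y s'"
  shows "ext_lift l y (boundary is) = 0"
proof -
  define p q where "p = Suc (length as)" and "q = Suc (Suc (length as + length bs))"
  define w where "w j = wedge_list (map y (take (j - 1) is @ drop j is))" for j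
  have "ext_lift l y (boundary is) = (\<Sum>j=1..length is. fscale ((-1) ^ j) (w j))"
    unfolding boundary_def ext_lift_sum ext_lift_scale w_def
    by (intro sum.cong refl arg_cong[where f = "fscale _"] ext_lift_gens)
      (use assms(1) in \<open>auto dest: in_set_takeD in_set_dropD\<close>)
  also have "\<dots> = (\<Sum>j\<in>{p, q}. fscale ((-1) ^ j) (w j))"
  proof (rule sum.mono_neutral_right)
    show "{p, q} \<subseteq> {1..length is}" using assms(2) by (auto simp: p_def q_def)
    show "\<forall>j\<in>{1..length is} - {p, q}. fscale ((- 1) ^ j) (w j) = 0"
    proof
      fix j assume j: "j \<in> {1..length is} - {p, q}"
      consider "j < p" | "p < j" "j < q" | "q < j" using j by force
      then have "\<exists>as' bs' cs'. take (j - 1) is @ drop j is = as' @ s # bs' @ s' # cs'"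
      proof cases
        case 1
        then have "take (j - 1) is @ drop j is = (take (j - 1) as @ drop j as) @ s # bs @ s' # cs"
          using assms(2) by (simp add: p_def)
        then show ?thesis by blast
      next
        case 2
        then obtain k where k: "j = Suc (length as + Suc k)" "k < length bs"
          by (metis Suc_less_eq add_Suc_right less_imp_Suc_add p_def q_def nat_add_left_cancel_less add.commute)
        then have "take (j - 1) is @ drop j is = as @ s # (take k bs @ drop (Suc k) bs) @ s' # cs"
          using assms(2) by simp
        then show ?thesis by blast
      next
        case 3
        then obtain k where k: "j = Suc (Suc (Suc (length as + length bs + k)))"
          using less_imp_Suc_add[of q j] by (auto simp: q_def)
        then have "take (j - 1) is @ drop j is = as @ s # bs @ s' # (take k cs @ drop (Suc k) cs)"
          using assms(2) by (simp add: numeral_3_eq_3)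
        then show ?thesis by blast
      qed
      then have "w j = 0" unfolding w_def using wedge_list_repeated[OF assms(3)] by metis
      then show "fscale ((- 1) ^ j) (w j) = 0" by simp
    qed
  qed simp
  also have "\<dots> = fscale ((-1) ^ p) (w p) + fscale ((-1) ^ q) (w q)"
    by (simp add: p_def q_def)
  also have "w p = fscale ((-1) ^ length bs) (w q)"
  proof -
    have "w p = wedge_list (map y (as @ bs @ s' # cs))"
      "w q = wedge_list (map y (as @ s # bs @ cs))"
      using assms(2) by (simp_all add: w_def p_def q_def)
    moreover have "wedge_list (map y (as @ bs @ s' # cs)) =
        fscale ((-1) ^ length bs) (wedge_list (map y (as @ s # bs @ cs)))"
      using wedge_list_pull[of bs s' cs] assms(3)
      by (induction as) (simp_all add: wedge_list_Cons wedge_fscale_right)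
    ultimately show ?thesis by simp
  qed
  also have "fscale ((-1) ^ p) (fscale ((-1) ^ length bs) (w q)) + fscale ((-1) ^ q) (w q) = 0"
    by (simp add: fscale_def fun_eq_iff p_def q_def power_add)
  finally show ?thesis .
qed

end


section \<open>Top exterior powers and determinants\<close>

lemma wedge_gen_apply:
  assumes "finite S"
  shows "wedge (gen k) g S = (if k \<in> S then (-1) ^ inversions {k} (S - {k}) * g (S - {k}) else 0)"
proof -
  have "wedge (gen k) g S =
      (\<Sum>T\<in>Pow S. if T = {k} then (-1) ^ inversions {k} (S - {k}) * g (S - {k}) else 0)"
    unfolding wedge_def by (intro sum.cong refl) (auto simp: gen_def ext_monom_def)
  then show ?thesis using assms by (simp add: sum.delta)
qed

lemma wedge_linear_elem_apply:
  assumes "S \<subseteq> {1..m}"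
  shows "wedge (linear_elem m u) g S =
    (\<Sum>k\<in>S. (-1) ^ inversions {k} (S - {k}) * u k * g (S - {k}))"
proof -
  have fin: "finite S" using assms finite_subset by blast
  have "wedge (linear_elem m u) g S = (\<Sum>k=1..m. u k * wedge (gen k) g S)"
    unfolding linear_elem_def wedge_sum_left wedge_fscale_left
    by (simp add: sum_fun_apply fscale_apply)
  also have "\<dots> = (\<Sum>k\<in>S. u k * wedge (gen k) g S)"
    by (rule sum.mono_neutral_right) (use assms fin in \<open>auto simp: wedge_gen_apply\<close>)
  also have "\<dots> = (\<Sum>k\<in>S. (-1) ^ inversions {k} (S - {k}) * u k * g (S - {k}))"
    by (intro sum.cong refl) (simp add: wedge_gen_apply fin)
  finally show ?thesis .
qed

lemma inversions_nth_sorted: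
  assumes "sorted_wrt (<) xs" "j < length xs"
  shows "inversions {xs ! j} (set xs - {xs ! j}) = j"
proof -
  have mono: "xs ! a < xs ! b \<longleftrightarrow> a < b" if "a < length xs" "b < length xs" for a b
    using that assms(1) by (metis linorder_neqE_nat order.asym sorted_wrt_nth_less)
  have "{(a, b). a \<in> {xs ! j} \<and> b \<in> set xs - {xs ! j} \<and> b < a} = (\<lambda>a. (xs ! j, xs ! a)) ` {..<j}"
  proof (rule equalityI; rule subsetI)
    fix p assume "p \<in> {(a, b). a \<in> {xs ! j} \<and> b \<in> set xs - {xs ! j} \<and> b < a}"
    then obtain a where "p = (xs ! j, xs ! a)" "a < length xs" "xs ! a < xs ! j"
      by (auto simp: in_set_conv_nth)
    then show "p \<in> (\<lambda>a. (xs ! j, xs ! a)) ` {..<j}" using mono assms(2) by auto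
  next
    fix p assume "p \<in> (\<lambda>a. (xs ! j, xs ! a)) ` {..<j}"
    then obtain a where a: "p = (xs ! j, xs ! a)" "a < j" by auto
    then have "xs ! a < xs ! j" using mono[of a j] assms(2) by simp
    then show "p \<in> {(a, b). a \<in> {xs ! j} \<and> b \<in> set xs - {xs ! j} \<and> b < a}"
      using a assms(2) by auto
  qed
  moreover have "inj_on (\<lambda>a. (xs ! j, xs ! a)) {..<j}"
    using assms by (auto simp: inj_on_def nth_eq_iff_index_eq strict_sorted_iff)
  ultimately show ?thesis by (simp add: inversions_def card_image)
qed

text \<open>Expanding the wedge product along its first factor is the Laplace expansion of the determinant
  along its first row: the sign with which \<open>x\<^sub>k\<close> is split off from \<open>x\<^sub>S\<close> counts the elements of \<open>S\<close>
  below \<open>k\<close>, that is, the position of \<open>k\<close> in \<open>S\<close>.\<close>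
lemma wedge_list_linear_elems_eq_det:
  assumes "S \<subseteq> {1..m}" "card S = length us"
  shows "wedge_list (map (linear_elem m) us) S =
    det (mat (length us) (length us) (\<lambda>(i, j). (us ! i) (sorted_list_of_set S ! j)))"
  using assms
proof (induction us arbitrary: S)
  case Nil
  then have "S = {}" using finite_subset by fastforce
  then show ?case by (simp add: wedge_list_Nil ext_monom_def)
next
  case (Cons u us)
  define r xs where "r = length us" and "xs = sorted_list_of_set S"
  have fin: "finite S" using Cons.prems(1) finite_subset by blast
  have xs: "sorted_wrt (<) xs" "set xs = S" "length xs = Suc r" "distinct xs"
    using fin Cons.prems(2) by (simp_all add: xs_def r_def)
  define A where "A = mat (Suc r) (Suc r) (\<lambda>(i, j). ((u # us) ! i) (xs ! j))"
  have term_eq: "(-1) ^ inversions {xs ! j} (S - {xs ! j}) * u (xs ! j) *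
      wedge_list (map (linear_elem m) us) (S - {xs ! j}) = A $$ (0, j) * cofactor A 0 j"
    if j: "j < Suc r" for j
  proof -
    have del: "sorted_list_of_set (S - {xs ! j}) = take j xs @ drop (Suc j) xs"
    proof -
      have split: "xs = take j xs @ xs ! j # drop (Suc j) xs"
        using j xs(3) by (simp add: id_take_nth_drop)
      have "sorted_wrt (<) (take j xs @ xs ! j # drop (Suc j) xs)" using xs(1) split by simp
      then have "sorted_wrt (<) (take j xs @ drop (Suc j) xs)"
        by (auto simp: sorted_wrt_append)
      moreover have "set (take j xs @ drop (Suc j) xs) = S - {xs ! j}"
      proof -
        have "distinct (take j xs @ xs ! j # drop (Suc j) xs)" using xs(4) split by simp
        moreover have "S = set (take j xs @ xs ! j # drop (Suc j) xs)" using xs(2) split by simp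
        ultimately show ?thesis by auto
      qed
      ultimately show ?thesis
        by (metis sorted_list_of_set.idem_if_sorted_distinct strict_sorted_iff)
    qed
    have "card (S - {xs ! j}) = length us"
      using Cons.prems(2) fin j xs by (auto simp: card_Diff_singleton)
    then have "wedge_list (map (linear_elem m) us) (S - {xs ! j}) =
        det (mat r r (\<lambda>(i, k). (us ! i) ((take j xs @ drop (Suc j) xs) ! k)))"
      using Cons.IH[of "S - {xs ! j}"] Cons.prems(1) by (auto simp: r_def del)
    also have "mat r r (\<lambda>(i, k). (us ! i) ((take j xs @ drop (Suc j) xs) ! k)) = mat_delete A 0 j"
      using j xs(3) by (intro eq_matI) (auto simp: mat_delete_def A_def nth_append)
    finally show ?thesis
      using inversions_nth_sorted[OF xs(1), of j] j xs
      by (simp add: cofactor_def A_def mult_ac)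
  qed
  have "wedge_list (map (linear_elem m) (u # us)) S =
      (\<Sum>k\<in>S. (-1) ^ inversions {k} (S - {k}) * u k * wedge_list (map (linear_elem m) us) (S - {k}))"
    using wedge_linear_elem_apply[OF Cons.prems(1)] by (simp add: wedge_list_Cons)
  also have "\<dots> = (\<Sum>j<Suc r. (-1) ^ inversions {xs ! j} (S - {xs ! j}) * u (xs ! j) *
      wedge_list (map (linear_elem m) us) (S - {xs ! j}))"
    by (rule sum.reindex_bij_betw[symmetric], rule bij_betw_nth) (use xs in auto)
  also have "\<dots> = (\<Sum>j<Suc r. A $$ (0, j) * cofactor A 0 j)"
    by (intro sum.cong refl term_eq) simp
  also have "\<dots> = det A"
    by (rule laplace_expansion_row[symmetric]) (simp_all add: A_def)
  finally show ?case by (simp add: A_def r_def xs_def)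
qed

text \<open>The determinant is used in this form only: the rows \<open>us\<close> are dependent if and only if a nontrivial
  combination of the columns is zero.\<close>
lemma top_wedge_zero_iff_kernel:
  assumes "length us = n"
  shows "wedge_list (map (linear_elem n) us) {1..n} = 0 \<longleftrightarrow>
    (\<exists>v. (\<exists>k\<in>{1..n}. v k \<noteq> 0) \<and> (\<forall>u\<in>set us. (\<Sum>k=1..n. u k * v k) = 0))"
    (is "?L \<longleftrightarrow> ?R")
proof -
  define A where "A = mat n n (\<lambda>(i, j). (us ! i) (Suc j))"
  have "sorted_list_of_set {1..n} ! j = Suc j" if "j < n" for j
    using that by (simp add: atLeastAtMost_upt del: upt_Suc)
  then have "mat n n (\<lambda>(i, j). (us ! i) (sorted_list_of_set {1..n} ! j)) = A"
    by (intro eq_matI) (auto simp: A_def)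
  then have "?L \<longleftrightarrow> det A = 0"
    using wedge_list_linear_elems_eq_det[of "{1..n}" n us] assms by simp
  also have "\<dots> \<longleftrightarrow> (\<exists>v. v \<in> carrier_vec n \<and> v \<noteq> 0\<^sub>v n \<and> A *\<^sub>v v = 0\<^sub>v n)"
    by (rule det_0_iff_vec_prod_zero_field) (simp add: A_def)
  also have "\<dots> \<longleftrightarrow> ?R"
  proof
    assume "\<exists>v. v \<in> carrier_vec n \<and> v \<noteq> 0\<^sub>v n \<and> A *\<^sub>v v = 0\<^sub>v n"
    then obtain v where v: "v \<in> carrier_vec n" "v \<noteq> 0\<^sub>v n" "A *\<^sub>v v = 0\<^sub>v n" by blast
    define w where "w k = v $ (k - 1)" for k
    have "\<exists>j<n. v $ j \<noteq> 0"
    proof (rule ccontr)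
      assume "\<not> ?thesis"
      then have "v = 0\<^sub>v n" using v(1) by (intro eq_vecI) auto
      then show False using v(2) by simp
    qed
    then obtain j where j: "j < n" "v $ j \<noteq> 0" by blast
    have "(\<Sum>k=1..n. u k * w k) = 0" if "u \<in> set us" for u
    proof -
      have "\<exists>i<n. u = us ! i" using that assms by (auto simp: in_set_conv_nth)
      then obtain i where i: "i < n" "u = us ! i" by blast
      have "(\<Sum>k=1..n. u k * w k) = (\<Sum>j<n. u (Suc j) * v $ j)"
        by (simp add: One_nat_def sum.atLeast1_atMost_eq w_def)
      also have "\<dots> = (A *\<^sub>v v) $ i"
        using i v(1) by (simp add: A_def scalar_prod_def lessThan_atLeast0)
      also have "\<dots> = 0" using v(3) i by simp
      finally show ?thesis .
    qed
    moreover have "w (Suc j) \<noteq> 0" "Suc j \<in> {1..n}" using j by (simp_all add: w_def)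
    ultimately show ?R by blast
  next
    assume ?R
    then obtain w j where w: "j \<in> {1..n}" "w j \<noteq> 0" "\<And>u. u \<in> set us \<Longrightarrow> (\<Sum>k=1..n. u k * w k) = 0"
      by blast
    define v where "v = vec n (\<lambda>j. w (Suc j))"
    have j: "j - 1 < n" "Suc (j - 1) = j" using w(1) by auto
    then have "v $ (j - 1) \<noteq> 0" using w(2) by (simp add: v_def)
    then have "v \<noteq> 0\<^sub>v n" using j(1) by auto
    moreover have "A *\<^sub>v v = 0\<^sub>v n"
    proof (rule eq_vecI)
      fix i assume "i < dim_vec (0\<^sub>v n :: complex vec)"
      then have i: "i < n" by simp
      then have "(A *\<^sub>v v) $ i = (\<Sum>j<n. (us ! i) (Suc j) * w (Suc j))"
        by (simp add: A_def v_def scalar_prod_def lessThan_atLeast0)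
      also have "\<dots> = 0"
        using w(3)[of "us ! i"] i assms by (simp add: One_nat_def sum.atLeast1_atMost_eq)
      finally show "(A *\<^sub>v v) $ i = 0\<^sub>v n $ i" using i by simp
    qed (simp add: A_def)
    moreover have "v \<in> carrier_vec n" by (simp add: v_def)
    ultimately show "\<exists>v. v \<in> carrier_vec n \<and> v \<noteq> 0\<^sub>v n \<and> A *\<^sub>v v = 0\<^sub>v n" by blast
  qed
  finally show ?thesis .
qed


lemma wedge_list_linear_elems_degree:
  assumes "T \<subseteq> {1..m}" "wedge_list (map (linear_elem m) us) T \<noteq> 0"
  shows "card T = length us"
  using assms
proof (induction us arbitrary: T)
  case Nil
  then show ?case by (simp add: wedge_list_Nil ext_monom_def split: if_splits)
next
  case (Cons u us)
  have fin: "finite T" using Cons.prems(1) finite_subset by blast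
  obtain k where k: "k \<in> T" "wedge_list (map (linear_elem m) us) (T - {k}) \<noteq> 0"
  proof -
    have "\<exists>k\<in>T. wedge_list (map (linear_elem m) us) (T - {k}) \<noteq> 0"
    proof (rule ccontr)
      assume "\<not> ?thesis"
      then have "(\<Sum>k\<in>T. (-1) ^ inversions {k} (T - {k}) * u k *
          wedge_list (map (linear_elem m) us) (T - {k})) = 0"
        by (intro sum.neutral) simp
      then show False
        using Cons.prems(2) wedge_linear_elem_apply[OF Cons.prems(1), of u "wedge_list (map (linear_elem m) us)"]
        by (simp add: wedge_list_Cons)
    qed
    then show ?thesis by (elim bexE) (rule that)
  qed
  have "card (T - {k}) = length us" by (rule Cons.IH[OF _ k(2)]) (use Cons.prems(1) in blast)
  then show ?case using card.remove[OF fin k(1)] by simp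
qed


section \<open>The Orlik-Solomon ideal\<close>

lemma os_relations_carrier: "os_relations n l H \<subseteq> carrier (ext_alg l)"
  by (auto simp: os_relations_def ext_alg_def gens_in_carrier boundary_in_carrier)

lemma os_ideal_is_ideal: "ideal (os_ideal n l H) (ext_alg l)"
  unfolding os_ideal_def by (rule ring.genideal_ideal[OF ring_ext_alg os_relations_carrier])

lemma os_relations_in_ideal: "r \<in> os_relations n l H \<Longrightarrow> r \<in> os_ideal n l H"
  unfolding os_ideal_def
  using ring.genideal_self[OF ring_ext_alg os_relations_carrier] by blast

lemma os_ideal_carrier: "os_ideal n l H \<subseteq> coord_space (Pow {1..l})"
proof -
  interpret ideal "os_ideal n l H" "ext_alg l" by (rule os_ideal_is_ideal)
  show ?thesis using a_subset by (simp add: ext_alg_def)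
qed

lemma os_ideal_wedge_left:
  assumes "g \<in> os_ideal n l H" "f \<in> coord_space (Pow {1..l})"
  shows "wedge f g \<in> os_ideal n l H"
proof -
  interpret ideal "os_ideal n l H" "ext_alg l" by (rule os_ideal_is_ideal)
  show ?thesis using I_l_closed[OF assms(1), of f] assms(2) by (simp add: ext_alg_def)
qed

lemma subspace_os_ideal: "cvec.subspace (os_ideal n l H)"
proof -
  interpret ideal "os_ideal n l H" "ext_alg l" by (rule os_ideal_is_ideal)
  have one: "ext_monom {} \<in> coord_space (Pow {1..l})" by (rule ext_monom_in_carrier) simp
  show ?thesis
    unfolding cvec.subspace_def
  proof (intro conjI ballI allI)
    show "0 \<in> os_ideal n l H" using additive_subgroup.zero_closed[OF additive_subgroup_axioms]
      by (simp add: ext_alg_def)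
  next
    fix f g assume "f \<in> os_ideal n l H" "g \<in> os_ideal n l H"
    then show "f + g \<in> os_ideal n l H" 
      using additive_subgroup.a_closed[OF additive_subgroup_axioms, of f g] by (simp add: ext_alg_def)
  next
    fix a f assume f: "f \<in> os_ideal n l H"
    have "wedge (fscale a (ext_monom {})) f \<in> os_ideal n l H"
      by (rule os_ideal_wedge_left[OF f coord_space_scale[OF one]])
    moreover have "wedge (fscale a (ext_monom {})) f = fscale a f"
      using f os_ideal_carrier[of n l H] by (auto simp: wedge_fscale_left wedge_one_left)
    ultimately show "fscale a f \<in> os_ideal n l H" by simp
  qed
qed

lemma os_class_zero_iff:
  assumes "f \<in> coord_space (Pow {1..l})"
  shows "os_class n l H f = \<zero>\<^bsub>os_alg n l H\<^esub> \<longleftrightarrow> f \<in> os_ideal n l H"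
proof -
  interpret ideal "os_ideal n l H" "ext_alg l" by (rule os_ideal_is_ideal)
  have f: "f \<in> carrier (ext_alg l)" using assms by (simp add: ext_alg_def)
  have "\<zero>\<^bsub>os_alg n l H\<^esub> = os_ideal n l H" by (simp add: os_alg_def FactRing_def)
  then show ?thesis
    unfolding os_class_def using rcos_const_imp_mem[OF f] a_rcos_const by metis
qed

text \<open>The kernel of a ring homomorphism is an ideal, so it is enough to look at the relations.\<close>
lemma ext_lift_kills_os_ideal:
  assumes "anticommuting y m" "\<And>r. r \<in> os_relations n l H \<Longrightarrow> ext_lift l y r = 0"
    and "f \<in> os_ideal n l H"
  shows "ext_lift l y f = 0"
proof -
  interpret anticommuting y m by fact
  have "ext_lift l y (ext_monom {}) = ext_monom {}"
    using ext_lift_monom[of "{}" l y] by (simp add: wedge_list_Nil)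
  then interpret h: ring_hom_ring "ext_alg l" "ext_alg m" "ext_lift l y"
    by (intro ring_hom_ringI ring_ext_alg)
      (simp_all add: ext_alg_def ext_lift_closed ext_lift_wedge ext_lift_add)
  have ker: "a_kernel (ext_alg l) (ext_alg m) (ext_lift l y) =
      {f \<in> coord_space (Pow {1..l}). ext_lift l y f = 0}"
    unfolding a_kernel_def' by (simp add: ext_alg_def)
  have "os_ideal n l H \<subseteq> a_kernel (ext_alg l) (ext_alg m) (ext_lift l y)"
    unfolding os_ideal_def
  proof (rule ring.genideal_minimal[OF ring_ext_alg h.kernel_is_ideal])
    show "os_relations n l H \<subseteq> a_kernel (ext_alg l) (ext_alg m) (ext_lift l y)"
      using assms(2) os_relations_carrier[of n l H] unfolding ker by (auto simp: ext_alg_def)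
  qed
  then show ?thesis using assms(3) ker by auto
qed


section \<open>Ranks and codimensions\<close>

text \<open>With a choice of defining forms, statements about flats become statements about spans.\<close>
locale arrangement_forms =
  fixes n l :: nat and H :: "nat \<Rightarrow> point set" and c :: "nat \<Rightarrow> nat \<Rightarrow> complex"
  assumes form_coord: "i \<in> {1..l} \<Longrightarrow> c i \<in> coord_space {0..n}"
    and form_nonzero: "i \<in> {1..l} \<Longrightarrow> c i \<noteq> 0"
    and hyperplane_eq: "i \<in> {1..l} \<Longrightarrow>
      H i = {p \<in> proj_space n. \<forall>x\<in>p. (\<Sum>k=0..n. c i k * x k) = 0}"
begin

lemma mem_intersection_iff:
  assumes "I \<subseteq> {1..l}"
  shows "p \<in> intersection n H I \<longleftrightarrow>
    p \<in> proj_space n \<and> (\<forall>i\<in>I. \<forall>x\<in>p. (\<Sum>k=0..n. c i k * x k) = 0)"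
proof -
  have "p \<in> H i \<longleftrightarrow> p \<in> proj_space n \<and> (\<forall>x\<in>p. (\<Sum>k=0..n. c i k * x k) = 0)" if "i \<in> I" for i
    using hyperplane_eq[of i] that assms by blast
  then show ?thesis unfolding intersection_def by blast
qed

text \<open>Inserting 0 matters only for an empty intersection, where the annihilator is the zero space and
  the union of points is empty.\<close>
lemma insert_zero_Union_intersection:
  assumes "I \<subseteq> {1..l}"
  shows "insert 0 (\<Union>(intersection n H I)) = annih {0..n} (c ` I)"
proof (rule equalityI; rule subsetI)
  fix x assume "x \<in> insert 0 (\<Union>(intersection n H I))"
  then consider "x = 0" | p where "p \<in> intersection n H I" "x \<in> p" by auto
  then show "x \<in> annih {0..n} (c ` I)"
  proof cases
    case 1
    then show ?thesis using cvec.subspace_0[OF subspace_annih[of "{0..n}" "c ` I"]] by simp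
  next
    case 2
    then obtain z where z: "p = cvec_span {z}" "z \<in> coord_space {0..n}"
      using mem_intersection_iff[OF assms] by (auto simp: proj_space_def)
    then have "x \<in> coord_space {0..n}"
      using 2(2) by (auto simp: cvec.span_singleton intro: coord_space_scale)
    then show ?thesis using 2 mem_intersection_iff[OF assms] by (auto simp: annih_def)
  qed
next
  fix x assume x: "x \<in> annih {0..n} (c ` I)"
  show "x \<in> insert 0 (\<Union>(intersection n H I))"
  proof (cases "x = 0")
    case False
    then have "cvec_span {x} \<in> proj_space n" using x by (auto simp: proj_space_def annih_def)
    moreover have "cvec_span {x} \<subseteq> annih {0..n} (c ` I)"
      by (rule cvec.span_minimal) (use x subspace_annih in auto)
    ultimately have "cvec_span {x} \<in> intersection n H I"
      using mem_intersection_iff[OF assms] by (auto simp: annih_def)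
    moreover have "x \<in> cvec_span {x}" by (rule cvec.span_base) simp
    ultimately show ?thesis by blast
  qed simp
qed

lemma dim_Union_intersection:
  assumes "I \<subseteq> {1..l}"
  shows "cvec_dim (\<Union>(intersection n H I)) + cvec_dim (c ` I) = Suc n"
proof -
  have "cvec_dim (\<Union>(intersection n H I)) = cvec_dim (insert 0 (\<Union>(intersection n H I)))"
    by (rule cvec.span_eq_dim) simp
  also have "\<dots> = cvec_dim (annih {0..n} (c ` I))"
    by (simp only: insert_zero_Union_intersection[OF assms])
  moreover have "c ` I \<subseteq> coord_space {0..n}" using assms form_coord by blast
  ultimately show ?thesis
    using dim_annih[of "{0..n}" "c ` I"] finite_subset[OF assms] by simp
qed

lemma codim_intersection:
  "I \<subseteq> {1..l} \<Longrightarrow> codim n (intersection n H I) = cvec_dim (c ` I)"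
  using dim_Union_intersection[of I] by (simp add: codim_def)

lemma intersection_nonempty:
  assumes "I \<subseteq> {1..l}" "cvec_dim (c ` I) \<le> n"
  shows "intersection n H I \<noteq> {}"
proof
  assume "intersection n H I = {}"
  then show False
    using dim_Union_intersection[OF assms(1)] assms(2) cvec_dim_empty[where 'a = nat] by simp
qed

lemma subset_hyperplane_if_in_span:
  assumes "X \<subseteq> proj_space n" "I \<subseteq> {1..l}" "\<And>i. i \<in> I \<Longrightarrow> X \<subseteq> H i"
    and "j \<in> {1..l}" "c j \<in> cvec_span (c ` I)"
  shows "X \<subseteq> H j"
proof
  fix p assume p: "p \<in> X"
  have "(\<Sum>k=0..n. c j k * x k) = 0" if x: "x \<in> p" for x
  proof -
    have "cvec.subspace {e. (\<Sum>k=0..n. e k * x k) = 0}"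
      unfolding cvec.subspace_def
      by (auto simp: fscale_def distrib_right sum.distrib sum_distrib_left[symmetric] mult.assoc)
    moreover have "c ` I \<subseteq> {e. (\<Sum>k=0..n. e k * x k) = 0}"
      using assms(2,3) hyperplane_eq p x by blast
    ultimately have "cvec_span (c ` I) \<subseteq> {e. (\<Sum>k=0..n. e k * x k) = 0}"
      by (intro cvec.span_minimal)
    then show ?thesis using assms(5) by auto
  qed
  then show "p \<in> H j" using p assms(1,4) hyperplane_eq by auto
qed

text \<open>A form that vanishes on the intersection vanishes on the annihilator of the forms of \<open>I\<close>, so
  \<open>double_annihilator\<close> puts it into their span.  Flats thus correspond to closed sets of forms.\<close>
lemma intersection_subset_hyperplane_iff:
  assumes "I \<subseteq> {1..l}" "j \<in> {1..l}"
  shows "intersection n H I \<subseteq> H j \<longleftrightarrow> c j \<in> cvec_span (c ` I)"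
proof
  assume sub: "intersection n H I \<subseteq> H j"
  show "c j \<in> cvec_span (c ` I)"
  proof (rule double_annihilator[of "{0..n}"])
    show "finite (c ` I)" using finite_subset[OF assms(1)] by simp
    show "c ` I \<subseteq> coord_space {0..n}" "c j \<in> coord_space {0..n}" using assms form_coord by auto
    fix x assume "x \<in> annih {0..n} (c ` I)"
    then have "x = 0 \<or> (\<exists>p\<in>intersection n H I. x \<in> p)"
      using insert_zero_Union_intersection[OF assms(1)] by auto
    then show "(\<Sum>k=0..n. c j k * x k) = 0"
      using sub hyperplane_eq[OF assms(2)] by auto
  qed simp
next
  assume "c j \<in> cvec_span (c ` I)"
  then show "intersection n H I \<subseteq> H j"
    by (rule subset_hyperplane_if_in_span[rotated -1, OF _ _ assms(1)])
      (use assms in \<open>auto simp: intersection_def\<close>)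
qed

end


section \<open>The homomorphism attached to a flag\<close>

text \<open>The coordinates of the image of \<open>x\<^sub>j\<close> under the homomorphism attached to the flag \<open>S\<close>.\<close>
definition flag_form :: "nat \<Rightarrow> (nat \<Rightarrow> point set) \<Rightarrow> (nat \<Rightarrow> point set) \<Rightarrow> nat \<Rightarrow> nat \<Rightarrow> complex"
  where "flag_form n H S j = (\<lambda>k. if k \<in> {1..n} \<and> S k \<subseteq> H j then 1 else 0)"

abbreviation flag_elem :: "nat \<Rightarrow> (nat \<Rightarrow> point set) \<Rightarrow> (nat \<Rightarrow> point set) \<Rightarrow> nat \<Rightarrow> ext"
  where "flag_elem n H S j \<equiv> linear_elem n (flag_form n H S j)"

lemma anticommuting_flag_elem: "anticommuting (flag_elem n H S) n"
  by unfold_locales (rule linear_elem_anticomm, rule linear_elem_in_carrier)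

lemma flag_hom_product:
  "ext_lift l (flag_elem n H S) (wedge_list (map (\<lambda>i. linear_elem l (a i)) is)) =
    wedge_list (map (linear_elem n) (map (\<lambda>i k. \<Sum>j=1..l. a i j * flag_form n H S j k) is))"
proof -
  interpret anticommuting "flag_elem n H S" n by (rule anticommuting_flag_elem)
  have "ext_lift l (flag_elem n H S) (wedge_list (map (\<lambda>i. linear_elem l (a i)) is)) =
      wedge_list (map (\<lambda>i. ext_lift l (flag_elem n H S) (linear_elem l (a i))) is)"
    using ext_lift_wedge_list[of "map (\<lambda>i. linear_elem l (a i)) is" l]
    by (simp add: image_subset_iff linear_elem_in_carrier comp_def)
  then show ?thesis by (simp add: ext_lift_linear_elem sum_linear_elem comp_def)
qed

text \<open>The rows of the determinant are the images of the \<open>w\<^sub>i\<close>, and its columns are the vectors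
  \<open>v\<^bsub>S\<^sub>k\<^esub>\<close>.\<close>
lemma flag_hom_product_zero_iff:
  "ext_lift l (flag_elem n H S) (wedge_list (map (\<lambda>i. linear_elem l (a i)) [1..<Suc n])) {1..n} = 0
    \<longleftrightarrow> cvec_dim (cvec_span ((\<lambda>i. flat_vec n l H a (S i)) ` {1..n})) < n"
proof -
  define b where "b i k = (\<Sum>j=1..l. a i j * flag_form n H S j k)" for i k
  have b: "flat_vec n l H a (S k) i = (if i \<in> {1..n} then b i k else 0)" if "k \<in> {1..n}" for i k
  proof -
    have "b i k = (\<Sum>j=1..l. if S k \<subseteq> H j then a i j else 0)"
      unfolding b_def using that by (intro sum.cong) (auto simp: flag_form_def)
    also have "\<dots> = (\<Sum>j | j \<in> {1..l} \<and> S k \<subseteq> H j. a i j)"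
      by (subst sum.inter_filter[symmetric]) auto
    finally show ?thesis by (auto simp: flat_vec_def sum_fun_apply column_def)
  qed
  have "ext_lift l (flag_elem n H S) (wedge_list (map (\<lambda>i. linear_elem l (a i)) [1..<Suc n])) {1..n} = 0
      \<longleftrightarrow> wedge_list (map (linear_elem n) (map b [1..<Suc n])) {1..n} = 0"
    unfolding flag_hom_product b_def ..
  also have "\<dots> \<longleftrightarrow> (\<exists>v. (\<exists>k\<in>{1..n}. v k \<noteq> 0) \<and> (\<forall>i\<in>{1..n}. (\<Sum>k=1..n. b i k * v k) = 0))"
    by (subst top_wedge_zero_iff_kernel) (auto simp del: upt_Suc)
  also have "\<dots> \<longleftrightarrow> (\<exists>v. (\<exists>k\<in>{1..n}. v k \<noteq> 0) \<and>
      (\<Sum>k=1..n. fscale (v k) (flat_vec n l H a (S k))) = 0)"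
  proof -
    have "(\<Sum>k=1..n. fscale (v k) (flat_vec n l H a (S k))) i =
        (if i \<in> {1..n} then \<Sum>k=1..n. b i k * v k else 0)" for v i
      unfolding sum_fun_apply fscale_apply using b by (auto intro!: sum.cong sum.neutral)
    then have "(\<Sum>k=1..n. fscale (v k) (flat_vec n l H a (S k))) = 0 \<longleftrightarrow>
        (\<forall>i\<in>{1..n}. (\<Sum>k=1..n. b i k * v k) = 0)" for v
      unfolding fun_eq_iff zero_fun_apply by metis
    then show ?thesis by (simp only:)
  qed
  also have "\<dots> \<longleftrightarrow> \<not> indep (\<lambda>i. flat_vec n l H a (S i)) {1..n}"
    by (rule not_indep_iff_relation[symmetric]) simp
  also have "\<dots> \<longleftrightarrow> cvec_dim ((\<lambda>i. flat_vec n l H a (S i)) ` {1..n}) < n"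
    using dim_less_card_iff_not_indep[of "{1..n}" "\<lambda>i. flat_vec n l H a (S i)"] by simp
  finally show ?thesis by simp
qed

text \<open>The first step of the flag that lies in \<open>H j\<close>, with the value \<open>n + 1\<close> if there is none.  A flag
  takes values only at \<open>1, \<dots>, n\<close>, which is why 0 has to be excluded.\<close>
definition flag_entry :: "nat \<Rightarrow> (nat \<Rightarrow> point set) \<Rightarrow> (nat \<Rightarrow> point set) \<Rightarrow> nat \<Rightarrow> nat"
  where "flag_entry n H S j = (LEAST k. 1 \<le> k \<and> (n < k \<or> S k \<subseteq> H j))"

lemma flag_antimono:
  assumes "flag n l H S" "1 \<le> i" "i \<le> k" "k \<le> n"
  shows "S k \<subseteq> S i"
  using assms(3,4)
proof (induction rule: dec_induct)
  case (step k)
  have "S (Suc k) \<subseteq> S k" using assms(1,2) step by (auto simp: flag_def)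
  then show ?case using step by auto
qed simp

lemma flag_entry:
  shows flag_entry_ge: "1 \<le> flag_entry n H S j"
    and flag_entry_le: "flag_entry n H S j \<le> Suc n"
    and flag_entry_iff: "flag n l H S \<Longrightarrow> k \<in> {1..n} \<Longrightarrow> S k \<subseteq> H j \<longleftrightarrow> flag_entry n H S j \<le> k"
proof -
  let ?P = "\<lambda>k. 1 \<le> k \<and> (n < k \<or> S k \<subseteq> H j)"
  have P: "?P (Suc n)" by simp
  have L: "?P (flag_entry n H S j)" unfolding flag_entry_def by (rule LeastI[of ?P, OF P])
  then show "1 \<le> flag_entry n H S j" by simp
  show "flag_entry n H S j \<le> Suc n" unfolding flag_entry_def by (rule Least_le[of ?P, OF P])
  assume S: "flag n l H S" and k: "k \<in> {1..n}"
  show "S k \<subseteq> H j \<longleftrightarrow> flag_entry n H S j \<le> k"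
  proof
    assume "S k \<subseteq> H j"
    then show "flag_entry n H S j \<le> k"
      using k unfolding flag_entry_def by (intro Least_le) simp
  next
    assume le: "flag_entry n H S j \<le> k"
    then have "S (flag_entry n H S j) \<subseteq> H j" using L k by auto
    moreover have "S k \<subseteq> S (flag_entry n H S j)"
      using flag_antimono[OF S] L le k by auto
    ultimately show "S k \<subseteq> H j" by blast
  qed
qed

lemma flag_elem_cong:
  assumes "flag n l H S" "flag_entry n H S i = flag_entry n H S j"
  shows "flag_elem n H S i = flag_elem n H S j"
  using flag_entry_iff[OF assms(1)] assms(2) by (auto simp: flag_form_def fun_eq_iff cong: conj_cong)

lemma flag_elem_zero:
  assumes "\<And>k. k \<in> {1..n} \<Longrightarrow> \<not> S k \<subseteq> H j"
  shows "flag_elem n H S j = 0"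
proof -
  have "flag_form n H S j k = 0" for k using assms by (auto simp: flag_form_def)
  then show ?thesis by (simp add: linear_elem_def fscale_def fun_eq_iff sum_fun_apply)
qed

lemma split_list_if_not_inj:
  assumes "distinct is" "\<not> inj_on d (set is)"
  obtains as s bs s' cs where "is = as @ s # bs @ s' # cs" "d s = d s'"
proof -
  have "\<not> distinct (map d is)" using assms by (simp add: distinct_map)
  then obtain xs ys zs z where "map d is = xs @ [z] @ ys @ [z] @ zs"
    using not_distinct_decomp by blast
  then show ?thesis
    using that by (auto simp: map_eq_append_conv map_eq_Cons_conv append_eq_map_conv Cons_eq_map_conv)
qed

context arrangement_forms
begin

text \<open>Hyperplanes that enter a flag at different steps are independent: each one lies outside the
  closed set of those that entered before.\<close>

lemma indep_if_flag_entry_inj: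
  assumes "flag n l H S" "T \<subseteq> {1..l}" "inj_on (flag_entry n H S) T"
  shows "indep c T"
proof (rule indep_if_ranked)
  let ?d = "flag_entry n H S"
  fix s assume s: "s \<in> T"
  show "c s \<notin> cvec_span (c ` {s' \<in> T. ?d s' < ?d s})"
  proof
    assume span: "c s \<in> cvec_span (c ` {s' \<in> T. ?d s' < ?d s})"
    show False
    proof (cases "?d s = 1")
      case True
      have "\<not> ?d s' < 1" for s' using flag_entry_ge[of n H S s'] by linarith
      with True have none: "{s' \<in> T. ?d s' < ?d s} = {}" by simp
      have "c s = 0" using span unfolding none by simp
      then show False using s assms(2) form_nonzero by auto
    next
      case False
      define k where "k = ?d s - 1"
      have k: "k \<in> {1..n}" "k < ?d s"
        using False flag_entry_ge[of n H S s] flag_entry_le[of n H S s] by (auto simp: k_def)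
      have "S k \<subseteq> H s"
      proof (rule subset_hyperplane_if_in_span[OF _ _ _ _ span])
        have "flat n l H (S k)" using assms(1) k(1) by (simp add: flag_def)
        then show "S k \<subseteq> proj_space n" by (auto simp: flat_def intersection_def)
        show "{s' \<in> T. ?d s' < ?d s} \<subseteq> {1..l}" "s \<in> {1..l}" using assms(2) s by auto
        fix i assume "i \<in> {s' \<in> T. ?d s' < ?d s}"
        then show "S k \<subseteq> H i" using flag_entry_iff[OF assms(1) k(1)] by (auto simp: k_def)
      qed
      then show False using flag_entry_iff[OF assms(1) k(1)] k(2) by auto
    qed
  qed
qed (use assms finite_subset in auto)

text \<open>A dependent list contains two hyperplanes with the same entry, whose generators have equal images.  A
  list with empty intersection contains a hyperplane off the point \<open>S n\<close>, hence off the whole flag.\<close>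
lemma flag_hom_kills_os_relations:
  assumes S: "flag n l H S" and r: "r \<in> os_relations n l H"
  shows "ext_lift l (flag_elem n H S) r = 0"
proof -
  interpret anticommuting "flag_elem n H S" n by (rule anticommuting_flag_elem)
  from r consider (dep) "is" where "r = boundary is" "set is \<subseteq> {1..l}" "distinct is"
      "codim n (intersection n H (set is)) < length is"
    | (empty) "is" where "r = gens is" "set is \<subseteq> {1..l}" "intersection n H (set is) = {}"
    by (auto simp: os_relations_def)
  then show ?thesis
  proof cases
    case dep
    have "\<not> inj_on (flag_entry n H S) (set is)"
    proof
      assume "inj_on (flag_entry n H S) (set is)"
      then have "cvec_dim (c ` set is) = card (set is)"
        using indep_if_flag_entry_inj[OF S dep(2)] indep_dim by blast
      then show False using dep codim_intersection[OF dep(2)] by (simp add: distinct_card)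
    qed
    with dep(3) obtain as s bs s' cs
      where "is = as @ s # bs @ s' # cs" "flag_entry n H S s = flag_entry n H S s'"
      by (rule split_list_if_not_inj)
    then show ?thesis
      using boundary_vanishes_if_repeated[OF dep(2)] flag_elem_cong[OF S] dep(1) by blast
  next
    case empty
    have "\<exists>s\<in>set is. \<forall>k\<in>{1..n}. \<not> S k \<subseteq> H s"
    proof (rule ccontr)
      assume "\<not> ?thesis"
      then have all: "\<exists>k\<in>{1..n}. S k \<subseteq> H s" if "s \<in> set is" for s using that by blast
      have "intersection n H {} \<noteq> {}"
        by (rule intersection_nonempty) (simp_all add: cvec_dim_empty)
      then obtain s where "s \<in> set is" using empty(3) by (cases "is") auto
      then have n: "n \<in> {1..n}" using all by fastforce
      have "S n \<subseteq> H s" if "s \<in> set is" for s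
        using all[OF that] flag_antimono[OF S] n by (metis atLeastAtMost_iff order_trans order_refl)
      moreover have "S n \<noteq> {}" "S n \<subseteq> proj_space n"
        using S n by (auto simp: flag_def flat_def intersection_def)
      ultimately have "intersection n H (set is) \<noteq> {}" unfolding intersection_def by blast
      then show False using empty(3) by simp
    qed
    then obtain s where s: "s \<in> set is" "\<And>k. k \<in> {1..n} \<Longrightarrow> \<not> S k \<subseteq> H s" by blast
    have "wedge_list (map (flag_elem n H S) is) = 0"
      by (rule wedge_list_zero_factor[OF s(1)], rule flag_elem_zero, rule s(2))
    then show ?thesis using ext_lift_gens[OF empty(2)] empty(1) by simp
  qed
qed

lemma flag_hom_kills_os_ideal:
  "flag n l H S \<Longrightarrow> f \<in> os_ideal n l H \<Longrightarrow> ext_lift l (flag_elem n H S) f = 0"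
  by (rule ext_lift_kills_os_ideal[OF anticommuting_flag_elem flag_hom_kills_os_relations])

end


section \<open>Monomials without broken circuits\<close>

context arrangement_forms
begin

text \<open>A broken circuit is a circuit without its smallest element.  A set \<open>T\<close> contains one if and only if
  some \<open>j\<close> depends on the elements of \<open>T\<close> above \<open>j\<close>.  Stated with the elements from some \<open>t \<in> T\<close> on,
  the condition says that \<open>t\<close> is the least element of the closed set that they span.\<close>
definition nbc :: "nat set \<Rightarrow> bool"
  where "nbc T \<longleftrightarrow> T \<subseteq> {1..l} \<and>
    (\<forall>t\<in>T. \<forall>j\<in>{1..l}. c j \<in> cvec_span (c ` {s \<in> T. t \<le> s}) \<longrightarrow> t \<le> j)"

lemma nbc_le:
  assumes "nbc T" "t \<in> T" "j \<in> {1..l}" "c j \<in> cvec_span (c ` {s \<in> T. t \<le> s})"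
  shows "t \<le> j"
  using assms by (auto simp: nbc_def)

text \<open>If \<open>t\<close> depended on the larger elements of \<open>T\<close>, the smallest of these would not be the least
  element of the closed set that they span, since \<open>t\<close> lies in it.\<close>
lemma nbc_indep:
  assumes "nbc T"
  shows "indep c T"
proof (rule indep_if_ranked)
  have T: "T \<subseteq> {1..l}" using assms by (simp add: nbc_def)
  then show fin: "finite T" using finite_subset by blast
  have *: "l - s < l - t \<longleftrightarrow> t < s" if "s \<in> T" "t \<in> T" for s t
    using that T by auto
  show "inj_on (\<lambda>t. l - t) T"
  proof (rule inj_onI)
    fix s t assume "s \<in> T" "t \<in> T" "l - s = l - t"
    then show "s = t" using *[of s t] *[of t s] by simp
  qed
  fix t assume t: "t \<in> T"
  have above: "{s \<in> T. l - s < l - t} = {s \<in> T. t < s}" using * t by auto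
  show "c t \<notin> cvec_span (c ` {s \<in> T. l - s < l - t})"
  proof (cases "{s \<in> T. t < s} = {}")
    case True
    then show ?thesis using form_nonzero[of t] t T unfolding above True by auto
  next
    case False
    define u where "u = Min {s \<in> T. t < s}"
    have u: "u \<in> T" "t < u" using Min_in[OF _ False] fin by (auto simp: u_def)
    have "{s \<in> T. t < s} = {s \<in> T. u \<le> s}" using u fin by (auto simp: u_def)
    then show ?thesis
      using nbc_le[OF assms u(1), of t] t T u(2) unfolding above by auto
  qed
qed

text \<open>If \<open>c\<^sub>j\<close> with \<open>j < t\<close> is spanned by the forms of the indices \<open>s \<ge> t\<close> of \<open>T\<close>, then the
  boundary of \<open>j\<close> followed by these indices rewrites \<open>x\<^sub>T\<close> into monomials in which one of them is
  replaced by the smaller \<open>j\<close>.  So the sum of the indices decreases.\<close>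

lemma nbc_monomials_span:
  assumes "T \<subseteq> {1..l}" "card T = n"
  shows "ext_monom T \<in> cvec_span (os_ideal n l H \<union> ext_monom ` {U. nbc U \<and> card U = n})"
    (is "_ \<in> cvec_span ?W")
  using assms
proof (induction "\<Sum>T" arbitrary: T rule: less_induct)
  case less
  have fin: "finite T" using less.prems(1) finite_subset by blast
  show ?case
  proof (cases "nbc T")
    case True
    then show ?thesis using less.prems(2) by (intro cvec.span_base) blast
  next
    case False
    then obtain t j where tj: "t \<in> T" "j \<in> {1..l}" "j < t"
        "c j \<in> cvec_span (c ` {s \<in> T. t \<le> s})"
      using less.prems(1) by (auto simp: nbc_def not_le)
    define rs ls where "rs = sorted_list_of_set {s \<in> T. t \<le> s}"
      and "ls = sorted_list_of_set {s \<in> T. s < t}"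
    have rs: "set rs = {s \<in> T. t \<le> s}" "sorted_wrt (<) rs" "distinct rs"
      and ls: "set ls = {s \<in> T. s < t}" "sorted_wrt (<) ls"
      using fin by (simp_all add: rs_def ls_def)
    have set_lr: "set (ls @ rs) = T" unfolding set_append rs(1) ls(1) by auto
    have sorted_lr: "sorted_wrt (<) (ls @ rs)" 
      unfolding sorted_wrt_append rs(1) ls(1) using rs(2) ls(2) by auto
    then have dist_lr: "distinct (ls @ rs)" using strict_sorted_iff by blast
    have len_lr: "length (ls @ rs) = n" using distinct_card[OF dist_lr] set_lr less.prems(2) by simp
    have sum_lr: "sum_list (ls @ rs) = \<Sum>T"
      using sum_list_distinct_conv_sum_set[OF dist_lr, of id] set_lr by simp
    have sub: "set (j # rs) \<subseteq> {1..l}" using rs(1) tj(2) less.prems(1) by auto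
    have "boundary (j # rs) \<in> os_ideal n l H"
    proof -
      have "c ` set (j # rs) \<subseteq> cvec_span (c ` set rs)"
        using tj(4) rs(1) cvec.span_superset[of "c ` set rs"] by auto
      then have dim: "cvec_dim (c ` set (j # rs)) \<le> length rs"
        using cvec.dim_le_card[of "c ` set (j # rs)" "c ` set rs"] card_image_le[of "set rs" c]
          card_length[of rs] by simp
      moreover have "length rs \<le> n" using len_lr by simp
      ultimately have "intersection n H (set (j # rs)) \<noteq> {}"
        by (intro intersection_nonempty[OF sub]) simp
      moreover have "distinct (j # rs)" using rs tj(3) by auto
      moreover have "codim n (intersection n H (set (j # rs))) < length (j # rs)"
        using dim codim_intersection[OF sub] by simp
      ultimately have "boundary (j # rs) \<in> os_relations n l H"
        using sub unfolding os_relations_def by blast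
      then show ?thesis by (rule os_relations_in_ideal)
    qed
    then have "wedge (gens ls) (boundary (j # rs)) \<in> os_ideal n l H"
      using set_lr less.prems(1) by (intro os_ideal_wedge_left gens_in_carrier) auto
    then have relation: "wedge (gens ls) (boundary (j # rs)) \<in> cvec_span ?W"
      by (intro cvec.span_base) simp
    define g where "g q = wedge (gens ls) (gens (take (q - 1) (j # rs) @ drop q (j # rs)))" for q
    have "wedge (gens ls) (boundary (j # rs)) =
        (\<Sum>q=1..Suc (length rs). fscale ((-1) ^ q) (g q))"
      unfolding boundary_def wedge_sum_right wedge_fscale_right g_def by simp
    \<comment> \<open>The first term omits \<open>j\<close> and is the monomial of \<open>T\<close> itself; the others contain \<open>j\<close>.\<close>
    also have "\<dots> = fscale (-1) (g 1) + (\<Sum>q=2..Suc (length rs). fscale ((-1) ^ q) (g q))"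
      by (subst sum.atLeast_Suc_atMost) (simp_all add: numeral_2_eq_2 One_nat_def)
    also have "g 1 = ext_monom T"
      using gens_append[of rs l ls] sub sorted_lr set_lr gens_sorted[OF sorted_lr]
      by (simp add: g_def One_nat_def)
    finally have "ext_monom T = (\<Sum>q=2..Suc (length rs). fscale ((-1) ^ q) (g q))
        - wedge (gens ls) (boundary (j # rs))"
      by (simp add: fun_eq_iff fscale_def)
    moreover have "g q \<in> cvec_span ?W" if q: "q \<in> {2..Suc (length rs)}" for q
    proof -
      obtain p where p: "q = Suc (Suc p)" "p < length rs"
        using q by (metis Suc_le_D Suc_le_lessD Suc_le_mono atLeastAtMost_iff numeral_2_eq_2)
      define us where "us = ls @ j # take p rs @ drop (Suc p) rs"
      have "set (j # take p rs @ drop (Suc p) rs) \<subseteq> {1..l}"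
        using sub by (auto dest: in_set_takeD in_set_dropD)
      then have g_us: "g q = gens us"
        using gens_append[of "j # take p rs @ drop (Suc p) rs" l ls] by (simp add: g_def p us_def)
      show ?thesis
      proof (cases "gens us = 0")
        case True
        then show ?thesis unfolding g_us by (simp only: cvec.span_zero)
      next
        case False
        then obtain a where a: "distinct us" "gens us = fscale a (ext_monom (set us))"
          using gens_eq_scaled_monom[of us] by blast
        have rs_split: "rs = take p rs @ rs ! p # drop (Suc p) rs"
          using p(2) by (rule id_take_nth_drop)
        have "rs ! p \<in> set rs" using p(2) by simp
        then have "j < rs ! p" using rs(1) tj(3) by auto
        moreover have "sum_list rs = sum_list (take p rs) + rs ! p + sum_list (drop (Suc p) rs)"
          by (subst rs_split) simp
        ultimately have "sum_list us < sum_list (ls @ rs)" by (simp add: us_def)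
        then have "\<Sum>(set us) < \<Sum>T"
          using sum_list_distinct_conv_sum_set[OF a(1), of id] sum_lr by simp
        moreover have "set us \<subseteq> {1..l}"
          using sub ls(1) less.prems(1) by (auto simp: us_def dest: in_set_takeD in_set_dropD)
        moreover have "card (set us) = n"
          using distinct_card[OF a(1)] len_lr p(2) by (simp add: us_def)
        ultimately have "ext_monom (set us) \<in> cvec_span ?W" by (rule less.hyps)
        then show ?thesis unfolding g_us a(2) by (rule cvec.span_scale)
      qed
    qed
    ultimately show ?thesis
      by (simp only:) (intro cvec.span_diff cvec.span_sum cvec.span_scale relation)
  qed
qed

lemma flag_hom_monom:
  assumes "T \<subseteq> {1..l}"
  shows "ext_lift l (flag_elem n H S) (ext_monom T) =
    wedge_list (map (linear_elem n) (map (flag_form n H S) (sorted_list_of_set T)))"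
  using ext_lift_monom[OF assms] by (simp add: comp_def)

text \<open>The flag consists of the intersections of the \<open>k\<close> hyperplanes of largest index in \<open>T\<close>; let \<open>X\<^sub>k\<close> be the set of
  all hyperplanes that contain the \<open>k\<close>-th of them.  If the homomorphism does not kill \<open>x\<^sub>U\<close>, the elements
  of \<open>U\<close> enter the flag at pairwise different steps, hence \<open>U\<close> has \<open>k\<close> elements in \<open>X\<^sub>k\<close>, and
  being independent they span it.  As \<open>U\<close> is nbc, the least of them is the least element of \<open>X\<^sub>k\<close>.
  As \<open>T\<close> is nbc, the same is true of the \<open>k\<close>-th largest element of \<open>T\<close>.  So \<open>U\<close> contains all of \<open>T\<close>.\<close>

lemma nbc_dual_flag:
  assumes "nbc T" "card T = n"
  obtains S where "flag n l H S"
    "\<And>U. nbc U \<Longrightarrow> card U = n \<Longrightarrow>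
      ext_lift l (flag_elem n H S) (ext_monom U) {1..n} \<noteq> 0 \<longleftrightarrow> U = T"
proof -
  have T: "T \<subseteq> {1..l}" using assms(1) by (simp add: nbc_def)
  have fin: "finite T" using T finite_subset by blast
  define ts where "ts = rev (sorted_list_of_set T)"
  have ts: "set ts = T" "length ts = n" "distinct ts" "sorted_wrt (>) ts"
    using fin assms(2) by (simp_all add: ts_def sorted_wrt_rev)
  define top where "top k = set (take k ts)" for k
  define S where "S k = intersection n H (top k)" for k
  have top_T: "top k \<subseteq> T" for k using ts(1) set_take_subset[of k ts] by (simp add: top_def)
  then have top_l: "top k \<subseteq> {1..l}" for k using T by blast
  have card_top: "card (top k) = k" if "k \<le> n" for k
    using that ts(2,3) by (simp add: top_def distinct_card)
  have indep_top: "indep c (top k)" for k by (rule indep_subset[OF nbc_indep[OF assms(1)] top_T])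
  have S_iff: "S k \<subseteq> H j \<longleftrightarrow> c j \<in> cvec_span (c ` top k)" if "j \<in> {1..l}" for j k
    unfolding S_def by (rule intersection_subset_hyperplane_iff[OF top_l that])
  have dim_top: "cvec_dim (c ` top k) = k" if "k \<le> n" for k
    using indep_dim[OF indep_top] card_top[OF that] by simp
  have flag: "flag n l H S"
    unfolding flag_def
  proof (intro conjI ballI)
    fix k assume k: "k \<in> {1..n}"
    have "S k \<noteq> {}" unfolding S_def by (rule intersection_nonempty[OF top_l]) (use dim_top k in simp)
    moreover have "top k \<noteq> {}" using card_top[of k] k by auto
    ultimately show "flat n l H (S k)" unfolding flat_def S_def using top_l by blast
    show "codim n (S k) = k" unfolding S_def using codim_intersection[OF top_l] dim_top k by simp
  next
    fix k
    have "top k \<subseteq> top (Suc k)" unfolding top_def by (rule set_take_subset_set_take) simp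
    then show "S (Suc k) \<subseteq> S k" by (auto simp: S_def intersection_def)
  qed
  have upper: "{s \<in> T. ts ! k \<le> s} = top (Suc k)" if k: "k < n" for k
  proof -
    have less: "ts ! i > ts ! j" if "i < j" "j < n" for i j
      using that sorted_wrt_nth_less[OF ts(4)] ts(2) by auto
    have iff: "ts ! k \<le> ts ! i \<longleftrightarrow> i < Suc k" if "i < n" for i
      using less[of i k] less[of k i] that k by (cases i k rule: linorder_cases) auto
    have T_img: "T = (!) ts ` {0..<n}" using nth_image[of n ts] ts(1,2) by simp
    have "{s \<in> T. ts ! k \<le> s} = (!) ts ` {i \<in> {0..<n}. ts ! k \<le> ts ! i}"
      unfolding T_img by blast
    also have "{i \<in> {0..<n}. ts ! k \<le> ts ! i} = {0..<Suc k}" using iff k by auto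
    also have "(!) ts ` {0..<Suc k} = top (Suc k)"
      unfolding top_def by (rule nth_image) (use ts(2) k in simp)
    finally show ?thesis .
  qed
  have dual: "ext_lift l (flag_elem n H S) (ext_monom U) {1..n} \<noteq> 0 \<longleftrightarrow> U = T"
    if U: "nbc U" "card U = n" for U
  proof
    assume nz: "ext_lift l (flag_elem n H S) (ext_monom U) {1..n} \<noteq> 0"
    interpret anticommuting "flag_elem n H S" n by (rule anticommuting_flag_elem)
    have Ul: "U \<subseteq> {1..l}" using U(1) by (simp add: nbc_def)
    have finU: "finite U" using Ul finite_subset by blast
    define us where "us = sorted_list_of_set U"
    have us: "set us = U" "distinct us" using finU by (simp_all add: us_def)
    have nz': "wedge_list (map (flag_elem n H S) us) \<noteq> 0"
      using nz ext_lift_monom[OF Ul] by (auto simp: us_def)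
    let ?d = "flag_entry n H S"
    have inj: "inj_on ?d U"
    proof (rule ccontr)
      assume "\<not> inj_on ?d U"
      then obtain as s bs s' cs where s: "us = as @ s # bs @ s' # cs" "?d s = ?d s'"
        using split_list_if_not_inj[OF us(2), of ?d] us(1) by blast
      then show False using nz' wedge_list_repeated flag_elem_cong[OF flag s(2)] by blast
    qed
    have d_le: "?d u \<le> n" if "u \<in> U" for u
    proof (rule ccontr)
      assume "\<not> ?d u \<le> n"
      then have "flag_elem n H S u = 0"
        using flag_entry_iff[OF flag, of _ u] by (intro flag_elem_zero) auto
      then show False using nz' wedge_list_zero_factor that us(1) by blast
    qed
    have "?d ` U = {1..n}"
    proof (rule card_subset_eq)
      show "?d ` U \<subseteq> {1..n}" using d_le flag_entry_ge[of n H S] by auto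
    qed (use inj U(2) in \<open>simp_all add: card_image\<close>)
    have "ts ! k \<in> U" if k: "k < n" for k
    proof -
      define A where "A = {u \<in> U. S (Suc k) \<subseteq> H u}"
      have A: "A = {u \<in> U. ?d u \<le> Suc k}"
        using flag_entry_iff[OF flag] k by (auto simp: A_def)
      have "{1..Suc k} \<subseteq> ?d ` A"
      proof
        fix i assume i: "i \<in> {1..Suc k}"
        then have "i \<in> ?d ` U" using \<open>?d ` U = {1..n}\<close> k by auto
        then show "i \<in> ?d ` A" using i by (auto simp: A)
      qed
      then have "card {1..Suc k} \<le> card (?d ` A)"
        by (rule card_mono[rotated]) (use finU A in simp)
      also have "\<dots> \<le> card A" by (rule card_image_le) (use finU A in simp)
      finally have card_A: "Suc k \<le> card A" by simp
      have A_span: "c ` A \<subseteq> cvec_span (c ` top (Suc k))" using S_iff Ul by (auto simp: A_def)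
      have span: "cvec_span (c ` top (Suc k)) \<subseteq> cvec_span (c ` A)"
      proof (rule indep_spans_if_card[OF _ _ A_span])
        show "indep c A" by (rule indep_subset[OF nbc_indep[OF U(1)]]) (auto simp: A_def)
        show "card (top (Suc k)) \<le> card A" using card_top[of "Suc k"] card_A k by simp
      qed (simp add: top_def)
      define m where "m = Min A"
      have finA: "finite A" using finU by (simp add: A_def)
      have mA: "m \<in> A" unfolding m_def by (rule Min_in) (use finA card_A in auto)
      have t: "ts ! k \<in> T" using ts(1,2) k by auto
      have "ts ! k \<in> top (Suc k)" using upper[OF k] t by auto
      then have "c (ts ! k) \<in> cvec_span (c ` A)" using span cvec.span_base[of "c (ts ! k)" "c ` top (Suc k)"] by auto
      moreover have "A \<subseteq> {u \<in> U. m \<le> u}" using finA by (auto simp: A_def m_def)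
      ultimately have "c (ts ! k) \<in> cvec_span (c ` {u \<in> U. m \<le> u})"
        using cvec.span_mono[OF image_mono] by blast
      then have "m \<le> ts ! k" using nbc_le[OF U(1), of m "ts ! k"] mA t T by (auto simp: A_def)
      moreover have "ts ! k \<le> m"
        by (rule nbc_le[OF assms(1) t]) (use mA A_span Ul upper[OF k] in \<open>auto simp: A_def\<close>)
      ultimately show ?thesis using mA by (simp add: A_def)
    qed
    then have "T \<subseteq> U" using ts(1,2) by (auto simp: in_set_conv_nth)
    then show "U = T" using card_subset_eq[OF finU, of T] U(2) assms(2) by simp
  next
    assume UT: "U = T"
    have entry: "S k' \<subseteq> H (ts ! k) \<longleftrightarrow> Suc k \<le> k'" if k: "k < n" and k': "k' \<in> {1..n}" for k k'
    proof -
      have t: "ts ! k \<in> T" using k ts by auto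
      have "top k' = (!) ts ` {0..<k'}"
        unfolding top_def by (rule nth_image[symmetric]) (use k' ts(2) in simp)
      then have "Suc k \<le> k' \<longleftrightarrow> ts ! k \<in> top k'"
        using k k' ts(2,3) by (auto simp: nth_eq_iff_index_eq)
      moreover have "ts ! k \<in> top k' \<longleftrightarrow> c (ts ! k) \<in> cvec_span (c ` top k')"
      proof
        show "ts ! k \<in> top k' \<Longrightarrow> c (ts ! k) \<in> cvec_span (c ` top k')"
          by (intro cvec.span_base) simp
        show "c (ts ! k) \<in> cvec_span (c ` top k') \<Longrightarrow> ts ! k \<in> top k'"
          using indep_not_in_span[OF nbc_indep[OF assms(1)] t, of "top k'"] top_T by blast
      qed
      moreover have "ts ! k \<in> {1..l}" using t T by blast
      ultimately show ?thesis using S_iff by blast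
    qed
    show "ext_lift l (flag_elem n H S) (ext_monom U) {1..n} \<noteq> 0"
    proof
      assume "ext_lift l (flag_elem n H S) (ext_monom U) {1..n} = 0"
      then have "\<exists>v. (\<exists>k\<in>{1..n}. v k \<noteq> 0) \<and> (\<forall>t\<in>T. (\<Sum>k=1..n. flag_form n H S t k * v k) = 0)"
        using top_wedge_zero_iff_kernel[of "map (flag_form n H S) (sorted_list_of_set T)" n]
          flag_hom_monom[OF T] UT fin assms(2) by simp
      then obtain v k0 where v: "k0 \<in> {1..n}" "v k0 \<noteq> 0"
          "\<And>t. t \<in> T \<Longrightarrow> (\<Sum>k=1..n. flag_form n H S t k * v k) = 0" by blast
      \<comment> \<open>The hyperplane that enters at step \<open>K\<close> sees only the entries of \<open>v\<close> from \<open>K\<close> on, so that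
        its equation reduces to \<open>v K = 0\<close>.\<close>
      define K where "K = Max {k \<in> {1..n}. v k \<noteq> 0}"
      have K: "K \<in> {k \<in> {1..n}. v k \<noteq> 0}" unfolding K_def by (rule Max_in) (use v in auto)
      have max: "v k = 0" if "k \<in> {1..n}" "K < k" for k
      proof (rule ccontr)
        assume "v k \<noteq> 0"
        then have "k \<le> K" unfolding K_def using that by (intro Max_ge) auto
        then show False using that by simp
      qed
      define t where "t = ts ! (K - 1)"
      have t: "t \<in> T" using K ts by (auto simp: t_def)
      have "(\<Sum>k=1..n. flag_form n H S t k * v k) = (\<Sum>k=1..n. if k = K then v K else 0)"
      proof (intro sum.cong refl)
        fix k assume k: "k \<in> {1..n}"
        have "K - 1 < n" "Suc (K - 1) = K" using K by auto
        then have "S k \<subseteq> H t \<longleftrightarrow> K \<le> k" using entry[of "K - 1" k] k by (simp add: t_def)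
        then show "flag_form n H S t k * v k = (if k = K then v K else 0)"
          using k max[of k] by (auto simp: flag_form_def)
      qed
      also have "\<dots> = v K" using K by simp
      finally show False using v(3)[OF t] K by simp
    qed
  qed
  show thesis by (rule that[OF flag dual])
qed

text \<open>Modulo the ideal, \<open>f\<close> is a combination of nbc monomials, and the dual flag of each of them reads off its
  coefficient.\<close>
lemma in_os_ideal_if_flag_homs_vanish:
  assumes f: "f \<in> coord_space (Pow {1..l})" "\<And>T. T \<subseteq> {1..l} \<Longrightarrow> f T \<noteq> 0 \<Longrightarrow> card T = n"
    and vanish: "\<And>S. flag n l H S \<Longrightarrow> ext_lift l (flag_elem n H S) f {1..n} = 0"
  shows "f \<in> os_ideal n l H"
proof -
  define G where "G = {U. nbc U \<and> card U = n}"
  have "G \<subseteq> Pow {1..l}" by (auto simp: G_def nbc_def)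
  then have finG: "finite G" by (rule finite_subset) simp
  have "(\<Sum>T\<in>Pow {1..l}. fscale (f T) (ext_monom T)) \<in> cvec_span (os_ideal n l H \<union> ext_monom ` G)"
  proof (rule cvec.span_sum)
    fix T assume T: "T \<in> Pow {1..l}"
    show "fscale (f T) (ext_monom T) \<in> cvec_span (os_ideal n l H \<union> ext_monom ` G)"
    proof (cases "f T = 0")
      case True
      then have "fscale (f T) (ext_monom T) = 0" by (simp add: fscale_def fun_eq_iff)
      then show ?thesis by (simp only: cvec.span_zero)
    next
      case False
      then show ?thesis
        unfolding G_def using f(2) T by (intro cvec.span_scale nbc_monomials_span) auto
    qed
  qed
  then have "f \<in> cvec_span (os_ideal n l H \<union> ext_monom ` G)" using ext_expand[OF f(1)] by simp
  then obtain x y where xy: "f = x + y" "x \<in> cvec_span (os_ideal n l H)" "y \<in> cvec_span (ext_monom ` G)"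
    by (auto simp: cvec.span_Un)
  have x: "x \<in> os_ideal n l H"
    using xy(2) cvec.span_minimal[OF order_refl subspace_os_ideal[of n l H]] by blast
  have inj: "inj_on ext_monom G"
  proof (rule inj_onI)
    fix T U assume "ext_monom T = ext_monom U"
    then have "ext_monom T T = ext_monom U T" by simp
    then show "T = U" by (simp add: ext_monom_def split: if_splits)
  qed
  obtain b where "y = (\<Sum>v\<in>ext_monom ` G. fscale (b v) v)"
    using xy(3) cvec.span_finite[of "ext_monom ` G"] finG by auto
  then have y: "y = (\<Sum>U\<in>G. fscale (b (ext_monom U)) (ext_monom U))"
    by (simp add: sum.reindex[OF inj])
  have "b (ext_monom T) = 0" if T: "T \<in> G" for T
  proof -
    obtain S where S: "flag n l H S" "\<And>U. nbc U \<Longrightarrow> card U = n \<Longrightarrow>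
        ext_lift l (flag_elem n H S) (ext_monom U) {1..n} \<noteq> 0 \<longleftrightarrow> U = T"
      using nbc_dual_flag[of T] T by (auto simp: G_def)
    have "0 = ext_lift l (flag_elem n H S) f {1..n}" using vanish[OF S(1)] by simp
    also have "\<dots> = ext_lift l (flag_elem n H S) y {1..n}"
      unfolding xy(1) ext_lift_add flag_hom_kills_os_ideal[OF S(1) x] by simp
    also have "\<dots> = (\<Sum>U\<in>G. b (ext_monom U) * ext_lift l (flag_elem n H S) (ext_monom U) {1..n})"
      by (simp add: y ext_lift_sum ext_lift_scale sum_fun_apply fscale_apply)
    also have "\<dots> = (\<Sum>U\<in>G. if U = T then b (ext_monom T) * ext_lift l (flag_elem n H S) (ext_monom T) {1..n} else 0)"
      by (intro sum.cong refl) (use S(2) in \<open>auto simp: G_def\<close>)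
    also have "\<dots> = b (ext_monom T) * ext_lift l (flag_elem n H S) (ext_monom T) {1..n}"
      using T finG by simp
    finally show ?thesis using S(2)[of T] T by (auto simp: G_def)
  qed
  then have "y = 0" unfolding y by (intro sum.neutral ballI) (simp add: fscale_def fun_eq_iff)
  then show ?thesis using x xy(1) by simp
qed

end

lemma arrangement_has_forms:
  assumes "arrangement n l H"
  obtains c where "arrangement_forms n l H c"
proof -
  have "\<forall>i\<in>{1..l}. \<exists>c. c \<in> coord_space {0..n} \<and> c \<noteq> 0 \<and>
      H i = {p \<in> proj_space n. \<forall>x\<in>p. (\<Sum>k=0..n. c k * x k) = 0}"
    using assms by (auto simp: arrangement_def hyperplane_def)
  from bchoice[OF this] obtain c where c: "\<forall>i\<in>{1..l}. c i \<in> coord_space {0..n} \<and> c i \<noteq> 0 \<and>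
      H i = {p \<in> proj_space n. \<forall>x\<in>p. (\<Sum>k=0..n. c i k * x k) = 0}" ..
  have "arrangement_forms n l H c" by unfold_locales (use c in blast)+
  then show thesis by (rule that)
qed

theorem lemma8:
  fixes n l :: nat
    and H :: "nat \<Rightarrow> point set"
    and a :: "nat \<Rightarrow> nat \<Rightarrow> complex"
  assumes "arrangement n l H"
  shows "os_class n l H (wedge_list (map (\<lambda>i. linear_elem l (a i)) [1..<Suc n]))
           = \<zero>\<^bsub>os_alg n l H\<^esub> \<longleftrightarrow>
         (\<forall>S. flag n l H S \<longrightarrow>
           cvec_dim (cvec_span ((\<lambda>i. flat_vec n l H a (S i)) ` {1..n})) < n)"
proof -
  obtain c where "arrangement_forms n l H c" using arrangement_has_forms[OF assms] .
  then interpret arrangement_forms n l H c .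
  let ?w = "wedge_list (map (\<lambda>i. linear_elem l (a i)) [1..<Suc n])"
  have w: "?w \<in> coord_space (Pow {1..l})"
    by (rule wedge_list_in_carrier) (auto simp: linear_elem_in_carrier)
  have degree: "card T = n" if "T \<subseteq> {1..l}" "?w T \<noteq> 0" for T
    using wedge_list_linear_elems_degree[of T l "map a [1..<Suc n]"] that
    by (simp add: comp_def del: upt_Suc)
  have "?w \<in> os_ideal n l H \<longleftrightarrow>
      (\<forall>S. flag n l H S \<longrightarrow> ext_lift l (flag_elem n H S) ?w {1..n} = 0)"
    using in_os_ideal_if_flag_homs_vanish[OF w degree] flag_hom_kills_os_ideal[of _ ?w] by auto
  then show ?thesis by (simp only: os_class_zero_iff[OF w] flag_hom_product_zero_iff)
qed

end
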